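(* Let $T$ denote the set of nonnegative integers for which the sum of any two consecutive digits in the base-$3$ expansion is always less than $3$, and let $T'=\{t\in T : t\not\equiv 2\pmod 3\}$. For every integer $n\ge 1$ there is $L_0$ such that for all integers $L\ge L_0$ the following hold. (i) (Case $p=2$.) $\nu_2(S(2^L+n-1,n))=[n/2]+\bar n-1$, where $\bar n\in\{0,1\}$ is the residue of $n$ mod $2$, if and only if $n=2^{\varepsilon}(2s+1)$ with $0\le \varepsilon\le 2$, $s\ge 0$ and $\binom{3s}{s}$ odd. (ii) (Case $p=3$.) $\nu_3(S(2\cdot 3^L+n-1,n))=2[n/3]+\bar n-1$, where $\bar n\in\{0,1,2\}$ is the residue of $n$ mod $3$, if and only if $n\in(3T+1)\cup(3T'+2)\cup(9T+3)$ and $n\not\equiv 2\pmod 9$. (iii) If $n=9x+2$ with $x\ge 0$ an integer, then $\nu_3(S(2\cdot 3^L+n-1,n+1))\ge 6x$, with equality if and only if $x\in T$.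
   Context: $S(k,j)$ is the Stirling number of the second kind. $\nu_p(m)$ is the exponent of the prime $p$ in $m$; $[x]$ is the integer part. For integers $a,b$ and a set $A$ of integers, $aA+b=\{at+b : t\in A\}$. Integers with a one-digit base-$3$ expansion satisfy the digit condition vacuously. *)

theory Defs
  imports "HOL-Combinatorics.Stirling" "HOL-Computational_Algebra.Primes"
begin

definition digit3 :: "nat \<Rightarrow> nat \<Rightarrow> nat" where
  "digit3 t i = t div 3 ^ i mod 3"

(* The condition is stated for all positions i, i.e. it also covers the leading zeros of t.
   These are harmless: a pair of consecutive positions that involves a leading zero
   has digit sum at most 2. *)
definition T :: "nat set" where
  "T = {t. \<forall>i. digit3 t i + digit3 t (Suc i) < 3}"

definition T' :: "nat set" where
  "T' = {t \<in> T. t mod 3 \<noteq> 2}"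

definition affine_image :: "nat \<Rightarrow> nat \<Rightarrow> nat set \<Rightarrow> nat set" where
  "affine_image a b A = (\<lambda>t. a * t + b) ` A"

end

theory Submission
  imports Defs "HOL-Computational_Algebra.Formal_Power_Series" "HOL-Number_Theory.Residues"
begin

text \<open>
  Let \<open>m = [N/p]\<close>, \<open>k < N\<close> and \<open>e = (p-1)p\<^sup>L\<close> with \<open>L\<close> large. In
  \<open>\<plusminus> N! S(e+k,N) = \<Sum>\<^sub>i (-1)\<^sup>i C(N,i) i\<^sup>e\<^sup>+\<^sup>k\<close> one may replace \<open>i\<^sup>e\<close> by 0 or 1 according to whether
  \<open>p\<close> divides \<open>i\<close>. As \<open>\<Sum>\<^sub>i (-1)\<^sup>i C(N,i) i\<^sup>k = 0\<close>, only the multiples of \<open>p\<close> remain, with a factor \<open>p\<^sup>k\<close>.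
  Writing \<open>i\<^sup>k = \<Sum>\<^sub>j S(k,j) j! C(i,j)\<close>, one needs \<open>j! \<Sum>\<^sub>i (-1)\<^sup>p\<^sup>i C(N,pi) C(i,j)\<close>, which is \<open>j!\<close> times
  the coefficient of \<open>X\<^sup>N\<close> in \<open>(-X)\<^sup>p\<^sup>j (1-X)\<^sup>p\<^sup>-\<^sup>1 / ((1-X)\<^sup>p - (-X)\<^sup>p)\<^sup>j\<^sup>+\<^sup>1\<close>. The denominator is \<open>1 - pq\<close> to the
  power \<open>j+1\<close>, and expanding it shows that modulo \<open>p\<close> times the \<open>p\<close>-part of \<open>m!\<close> only \<open>j = m\<close> contributes, with
  value \<open>\<plusminus> m!\<close>. Hence \<open>\<nu>\<^sub>p(S(e+k,N)) + m \<ge> k\<close>, with equality iff \<open>p\<close> does not divide \<open>S(k,m)\<close>.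
  Modulo 2 and 3 the numbers \<open>S(k,m)\<close> are binomial coefficients, to which Lucas' theorem applies.
\<close>

unbundle fps_syntax

subsection \<open>Stirling numbers as alternating power sums\<close>

text \<open>This is (i - j) C(i,j) = (j + 1) C(i,j + 1), rearranged so that multiplication by i has
  the shape of the Stirling recurrence.\<close>

lemma mult_choose_eq: "i * (i choose j) = j * (i choose j) + Suc j * (i choose Suc j)"
  using Suc_times_binomial_eq[of i j] by (simp add: algebra_simps)

text \<open>Multiplying the expansion of \<open>i ^ k\<close> by \<open>i\<close> turns it into the
  one for \<open>Suc k\<close>, by \<open>mult_choose_eq\<close> and the Stirling recurrence. The
  coefficient \<open>Stirling k j * fact j\<close> counts surjections from k points onto j
  points.\<close>

lemma power_eq_sum_Stirling:
  "i ^ k = (\<Sum>j\<le>k. Stirling k j * fact j * (i choose j))" for i k :: nat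
proof (induction k)
  case 0
  then show ?case by simp
next
  case (Suc k)
  have "i ^ Suc k = (\<Sum>j\<le>k. Stirling k j * fact j * (i * (i choose j)))"
    by (simp add: Suc sum_distrib_left mult_ac)
  also have "\<dots> = (\<Sum>j\<le>k. j * Stirling k j * fact j * (i choose j))
      + (\<Sum>j\<le>k. Stirling k j * fact (Suc j) * (i choose Suc j))"
    by (subst mult_choose_eq) (simp add: algebra_simps sum.distrib)
  \<comment> \<open>The added top term vanishes since \<open>Stirling k (Suc k)\<close> is 0; the
    term j = 0 vanishes too, so the index can be shifted.\<close>
  also have "(\<Sum>j\<le>k. j * Stirling k j * fact j * (i choose j))
      = (\<Sum>j\<le>Suc k. j * Stirling k j * fact j * (i choose j))"
    by simp
  also have "\<dots> = (\<Sum>j\<le>k. Suc j * Stirling k (Suc j) * fact (Suc j) * (i choose Suc j))"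
    by (subst sum.atMost_Suc_shift) simp
  also have "\<dots> + (\<Sum>j\<le>k. Stirling k j * fact (Suc j) * (i choose Suc j))
      = (\<Sum>j\<le>k. Stirling (Suc k) (Suc j) * fact (Suc j) * (i choose Suc j))"
    by (simp add: algebra_simps sum.distrib)
  also have "\<dots> = (\<Sum>j\<le>Suc k. Stirling (Suc k) j * fact j * (i choose j))"
    by (subst sum.atMost_Suc_shift) simp
  finally show ?case .
qed

text \<open>The identity C(N,i) C(i,j) = C(N,j) C(N-j,i-j) pulls out C(N,j) and leaves the
  alternating sum of row N - j, which is zero unless j = N.\<close>

lemma alternating_sum_choose_choose:
  "(\<Sum>i\<le>N. (-1) ^ i * int (N choose i) * int (i choose j)) = (if j = N then (-1) ^ N else 0)"
proof (cases "j \<le> N")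
  case True
  have "(\<Sum>i\<le>N. (-1) ^ i * int (N choose i) * int (i choose j))
      = (\<Sum>i\<in>{j..N}. (-1) ^ i * int (N choose i) * int (i choose j))"
    by (rule sum.mono_neutral_right) (auto simp: not_le)
  also have "\<dots> = (\<Sum>i\<in>{j..N}. (-1) ^ i * int (N choose j) * int ((N - j) choose (i - j)))"
  proof (rule sum.cong[OF refl])
    fix i assume "i \<in> {j..N}"
    then have "(N choose i) * (i choose j) = (N choose j) * ((N - j) choose (i - j))"
      by (intro choose_mult) auto
    then have "int (N choose i) * int (i choose j) = int (N choose j) * int ((N - j) choose (i - j))"
      by (metis of_nat_mult)
    then show "(-1) ^ i * int (N choose i) * int (i choose j)
        = (-1) ^ i * int (N choose j) * int ((N - j) choose (i - j))"
      by (simp add: mult.assoc)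
  qed
  also have "\<dots> = (\<Sum>i\<le>N - j. (-1) ^ (i + j) * int (N choose j) * int ((N - j) choose i))"
    by (rule sum.reindex_bij_witness[of _ "\<lambda>i. i + j" "\<lambda>i. i - j"]) (use True in auto)
  also have "\<dots> = (-1) ^ j * int (N choose j) * (\<Sum>i\<le>N - j. (-1) ^ i * int ((N - j) choose i))"
    by (simp add: sum_distrib_left power_add mult_ac)
  also have "\<dots> = (if j = N then (-1) ^ N else 0)"
    using True choose_alternating_sum[of "N - j", where 'a = int] by auto
  finally show ?thesis .
next
  case False
  then show ?thesis by (auto intro!: sum.neutral simp: binomial_eq_0)
qed

text \<open>Used in two ways: as a formula for S(k,N), and for k < N, where
  \<open>Stirling k N\<close> is 0, as the vanishing of the sum.\<close>

lemma alternating_sum_choose_power: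
  "(\<Sum>i\<le>N. (-1) ^ i * int (N choose i) * int i ^ k) = (-1) ^ N * fact N * int (Stirling k N)"
proof -
  have "(\<Sum>i\<le>N. (-1) ^ i * int (N choose i) * int i ^ k)
      = (\<Sum>i\<le>N. \<Sum>j\<le>k. int (Stirling k j) * fact j * ((-1) ^ i * int (N choose i) * int (i choose j)))"
    by (simp add: power_eq_sum_Stirling sum_distrib_left mult_ac flip: of_nat_power)
  also have "\<dots> = (\<Sum>j\<le>k. int (Stirling k j) * fact j *
      (\<Sum>i\<le>N. (-1) ^ i * int (N choose i) * int (i choose j)))"
    by (subst sum.swap) (simp add: sum_distrib_left)
  also have "\<dots> = (-1) ^ N * fact N * int (Stirling k N)"
    by (auto simp: alternating_sum_choose_choose if_distrib cong: if_cong)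
  finally show ?thesis .
qed

subsection \<open>Valuations of factorials\<close>

text \<open>All factors lie strictly between the consecutive multiples p m and p (m + 1).\<close>

lemma prime_not_dvd_prod_block:
  assumes "prime (p :: nat)" "r < p"
  shows "\<not> p dvd (\<Prod>i\<in>{p * m<..p * m + r}. i)"
proof
  assume "p dvd (\<Prod>i\<in>{p * m<..p * m + r}. i)"
  then obtain i where i: "i \<in> {p * m<..p * m + r}" "p dvd i"
    using assms by (subst (asm) prime_dvd_prod_iff) auto
  from i(2) obtain c where "i = p * c" ..
  with i(1) have "p * m < p * c" "p * c < p * Suc m" using assms(2) by auto
  then show False by (simp only: mult_less_cancel1) auto
qed

lemma fact_mult_prod_block: "fact (a + r) = fact a * (\<Prod>i\<in>{a<..a + r}. i)" for a r :: nat
proof (induction r)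
  case (Suc r)
  have "{a<..a + Suc r} = insert (a + Suc r) {a<..a + r}" by auto
  with Suc show ?case by (simp add: algebra_simps)
qed simp

lemma multiplicity_fact_add_less:
  assumes "prime (p :: nat)" "r < p"
  shows "multiplicity p (fact (p * m + r) :: nat) = multiplicity p (fact (p * m) :: nat)"
proof -
  have "multiplicity p (\<Prod>i\<in>{p * m<..p * m + r}. i) = 0"
    using prime_not_dvd_prod_block[OF assms] by (rule not_dvd_imp_multiplicity_0)
  moreover have "(\<Prod>i\<in>{p * m<..p * m + r}. i) \<noteq> 0" by auto
  ultimately show ?thesis
    unfolding fact_mult_prod_block
    by (subst prime_elem_multiplicity_mult_distrib) (use assms in auto)
qed

text \<open>Of each p consecutive factors only the last, \<open>p * Suc m\<close>, is a multiple of
  p; it contributes 1 plus the valuation of \<open>Suc m\<close>.\<close>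

lemma multiplicity_fact_mult:
  assumes p: "prime (p :: nat)"
  shows "multiplicity p (fact (p * m) :: nat) = m + multiplicity p (fact m :: nat)"
proof (induction m)
  case (Suc m)
  have p1: "p > 1" "p > 0" using p by (auto simp: prime_gt_Suc_0_nat prime_gt_0_nat)
  have *: "p * Suc m = Suc (p * m + (p - 1))" using p1 by simp
  have "fact (p * Suc m) = p * Suc m * fact (p * m + (p - 1))" unfolding * fact_Suc by simp
  then have "multiplicity p (fact (p * Suc m) :: nat)
      = multiplicity p (p * Suc m) + multiplicity p (fact (p * m) :: nat)"
    using p multiplicity_fact_add_less[OF p, of "p - 1" m] p1
    by (simp only:) (subst prime_elem_multiplicity_mult_distrib, auto)
  also have "multiplicity p (p * Suc m) = Suc (multiplicity p (Suc m))"
    using p p1 by (subst multiplicity_times_same) auto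
  also have "multiplicity p (fact (Suc m) :: nat) = multiplicity p (Suc m) + multiplicity p (fact m :: nat)"
    unfolding fact_Suc using p by (simp del: mult_Suc, subst prime_elem_multiplicity_mult_distrib) auto
  ultimately show ?case using Suc by simp
qed simp

lemma multiplicity_fact:
  assumes "prime (p :: nat)"
  shows "multiplicity p (fact N :: nat) = N div p + multiplicity p (fact (N div p) :: nat)"
  using multiplicity_fact_add_less[OF assms, of "N mod p" "N div p"] multiplicity_fact_mult[OF assms]
    prime_gt_0_nat[OF assms] by simp

text \<open>With q = [l/p] > 0 the valuation is q plus that of q!, hence below 2q \<le> l by
  induction. For q = 0 it is 0.\<close>

lemma multiplicity_fact_less:
  assumes p: "prime (p :: nat)" and "l > 0"
  shows "multiplicity p (fact l :: nat) < l"
  using \<open>l > 0\<close>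
proof (induction l rule: less_induct)
  case (less l)
  have p2: "p \<ge> 2" using p by (rule prime_ge_2_nat)
  show ?case
  proof (cases "l div p = 0")
    case True
    then show ?thesis using less.prems by (simp add: multiplicity_fact[OF p])
  next
    case False
    have "l div p < l" using less.prems p2 by simp
    then have "multiplicity p (fact (l div p) :: nat) < l div p" using less.IH False by simp
    moreover have "2 * (l div p) \<le> l"
      using p2 by (meson div_times_less_eq_dividend le_trans mult_le_mono1 mult.commute order_refl times_div_less_eq_dividend mult_le_mono)
    ultimately show ?thesis by (subst multiplicity_fact[OF p]) simp
  qed
qed

text \<open>The terms that are negligible in the expansion of the sums below: \<open>p\<^sup>l / l!\<close> is divisible by \<open>p\<close>.\<close>

lemma prime_power_dvd_fact_choose:
  assumes p: "prime (p :: nat)" and l: "l > 0" and m: "m \<le> j + l"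
  shows "p ^ Suc (multiplicity p (fact m :: nat)) dvd fact j * ((j + l) choose l) * p ^ l"
proof -
  let ?\<nu> = "\<lambda>x :: nat. multiplicity p x"
  let ?x = "fact j * ((j + l) choose l) * p ^ l :: nat"
  have p0: "p > 0" "prime_elem p" using p by (auto simp: prime_gt_0_nat)
  \<comment> \<open>Thus \<open>?x\<close> is (j + l)! p^l / l!. Its valuation is that of (j + l)!
    plus l minus that of l!, and the last difference is at least 1.\<close>
  have eq: "?x * fact l = fact (j + l) * p ^ l"
    using binomial_fact_lemma[of l "j + l"] by (simp add: mult_ac)
  have "?\<nu> (fact (j + l)) + l = ?\<nu> (fact (j + l) * p ^ l)"
    using p0 by (subst prime_elem_multiplicity_mult_distrib) (auto simp: multiplicity_same_power p)
  also have "\<dots> = ?\<nu> ?x + ?\<nu> (fact l)"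
    unfolding eq[symmetric] using p0 by (subst prime_elem_multiplicity_mult_distrib) auto
  finally have "?\<nu> ?x + ?\<nu> (fact l) = ?\<nu> (fact (j + l)) + l" ..
  moreover have "?\<nu> (fact m) \<le> ?\<nu> (fact (j + l))"
    by (intro dvd_imp_multiplicity_le fact_dvd m) auto
  ultimately have "Suc (?\<nu> (fact m)) \<le> ?\<nu> ?x"
    using multiplicity_fact_less[OF p l] by linarith
  then show ?thesis by (rule multiplicity_dvd')
qed

subsection \<open>Binomial coefficients modulo a prime\<close>

text \<open>Coefficient form of (1 + X)^(n + p) = (1 + X)^n (1 + X^p) modulo p: in Vandermonde's sum
  only i = 0 and i = p survive.\<close>

lemma choose_add_prime_cong:
  assumes p: "prime (p :: nat)"
  shows "[(n + p) choose k = (n choose k) + (if p \<le> k then n choose (k - p) else 0)] (mod p)"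
proof -
  have p0: "p > 0" using p by (rule prime_gt_0_nat)
  have "(n + p) choose k = (\<Sum>i\<le>k. (p choose i) * (n choose (k - i)))"
    using vandermonde[of p n k] by (simp add: add.commute)
  also have "[\<dots> = (\<Sum>i\<le>k. (if i = 0 then n choose k else 0) + (if i = p then n choose (k - p) else 0))] (mod p)"
  proof (rule cong_sum)
    fix i assume "i \<in> {..k}"
    consider "i = 0" | "i = p" | "i > p" | "0 < i" "i < p" by linarith
    then show "[(p choose i) * (n choose (k - i))
        = (if i = 0 then n choose k else 0) + (if i = p then n choose (k - p) else 0)] (mod p)"
    proof cases
      case 4
      then have "p dvd p choose i" using p by (intro dvd_choose_prime) auto
      then show ?thesis using 4 by (simp add: cong_0_iff)
    qed (use p0 in \<open>auto simp: binomial_eq_0\<close>)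
  qed
  also have "(\<Sum>i\<le>k. (if i = 0 then n choose k else 0) + (if i = p then n choose (k - p) else 0))
      = (n choose k) + (if p \<le> k then n choose (k - p) else 0)"
    by (simp add: sum.distrib)
  finally show ?thesis .
qed

text \<open>Lucas' theorem for the last base-p digit. Raising N by one adds p to the upper argument,
  and the two terms given by \<open>choose_add_prime_cong\<close> recombine by Pascal's
  rule.\<close>

lemma lucas_binomial:
  assumes p: "prime (p :: nat)" and r: "r < p" and s: "s < p"
  shows "[(p * N + r) choose (p * M + s) = (N choose M) * (r choose s)] (mod p)"
proof (induction N arbitrary: M)
  case 0
  show ?case using r by (cases M) (auto simp: binomial_eq_0)
next
  case (Suc N)
  have *: "p * Suc N + r = (p * N + r) + p" by simp
  show ?case
  proof (cases M)
    case 0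
    then show ?thesis
      using choose_add_prime_cong[OF p, of "p * N + r" s] Suc[of 0] s unfolding *
      by (auto intro: cong_trans)
  next
    case (Suc M')
    have "[(p * N + r + p) choose (p * M + s)
        = ((p * N + r) choose (p * M + s)) + ((p * N + r) choose (p * M' + s))] (mod p)"
      using choose_add_prime_cong[OF p, of "p * N + r" "p * M + s"] \<open>M = Suc M'\<close> by (simp add: algebra_simps)
    also have "[((p * N + r) choose (p * M + s)) + ((p * N + r) choose (p * M' + s))
        = (N choose M) * (r choose s) + (N choose M') * (r choose s)] (mod p)"
      by (intro cong_add Suc.IH)
    also have "(N choose M) * (r choose s) + (N choose M') * (r choose s) = (Suc N choose M) * (r choose s)" by (simp add: \<open>M = Suc M'\<close> algebra_simps)
    finally show ?thesis unfolding * .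
  qed
qed

subsection \<open>Generating functions of sums over multiples of a prime\<close>

text \<open>Lets congruence modulo X^M stand for agreement of the first M coefficients, so that
  truncated series can be handled by ring identities.\<close>

lemma fps_X_power_dvd_iff: "fps_X ^ M dvd (f :: 'a :: comm_ring_1 fps) \<longleftrightarrow> (\<forall>n<M. f $ n = 0)"
proof
  assume "\<forall>n<M. f $ n = 0"
  then have "f = fps_X ^ M * fps_shift M f"
    by (intro fps_ext) (simp add: fps_X_power_mult_nth)
  then show "fps_X ^ M dvd f" by (rule dvdI)
qed (auto simp: dvd_def fps_X_power_mult_nth)

lemma of_int_mult_fps_nth: "(of_int c * f) $ n = c * f $ n" for f :: "int fps"
  by (simp flip: fps_of_int)

lemma fps_nth_mult_eq_0:
  fixes f g :: "'a :: comm_ring_1 fps"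
  assumes "\<And>n. n > a \<Longrightarrow> f $ n = 0" "\<And>n. n > b \<Longrightarrow> g $ n = 0" "n > a + b"
  shows "(f * g) $ n = 0"
  unfolding fps_mult_nth
proof (rule sum.neutral, rule ballI)
  fix i assume "i \<in> {0..n}"
  then have "i > a \<or> n - i > b" using assms(3) by auto
  then show "f $ i * g $ (n - i) = 0" using assms(1,2) by auto
qed

lemma fps_nth_power_eq_0:
  fixes f :: "'a :: comm_ring_1 fps"
  assumes "\<And>n. n > a \<Longrightarrow> f $ n = 0" "n > a * l"
  shows "(f ^ l) $ n = 0"
  using assms(2)
proof (induction l arbitrary: n)
  case (Suc l)
  show ?case unfolding power_Suc
    by (rule fps_nth_mult_eq_0[OF assms(1) Suc.IH]) (use Suc.prems in auto)
qed simp

text \<open>The negative binomial series of (1 - w)^(-j-1), truncated after l = N. Stated as a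
  divisibility, it holds in any commutative ring and needs no inverse.\<close>

lemma one_minus_power_negative_binomial_dvd:
  fixes w :: "'a :: comm_ring_1"
  shows "w ^ Suc N dvd (1 - w) ^ Suc j * (\<Sum>l\<le>N. of_nat ((j + l) choose l) * w ^ l) - 1"
proof (induction j)
  case 0
  have "(1 - w) * (\<Sum>l\<le>N. w ^ l) = 1 - w ^ Suc N"
    by (rule sum_gp_basic)
  then show ?case by simp
next
  case (Suc j)
  \<comment> \<open>By Pascal's rule the product telescopes to the sum for j, up to one boundary
    term of order \<open>Suc N\<close>.\<close>
  have step: "(1 - w) * (\<Sum>l\<le>N. of_nat ((Suc j + l) choose l) * w ^ l)
      = (\<Sum>l\<le>N. of_nat ((j + l) choose l) * w ^ l) - of_nat ((Suc j + N) choose N) * w ^ Suc N" for N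
  proof (induction N)
    case (Suc N)
    show ?case unfolding sum.atMost_Suc distrib_left Suc.IH
      by (simp add: algebra_simps)
  qed (simp add: algebra_simps)
  have "(1 - w) ^ Suc (Suc j) * (\<Sum>l\<le>N. of_nat ((Suc j + l) choose l) * w ^ l) - 1
      = (1 - w) ^ Suc j * ((1 - w) * (\<Sum>l\<le>N. of_nat ((Suc j + l) choose l) * w ^ l)) - 1"
    by (simp only: power_Suc mult_ac)
  also have "\<dots> = ((1 - w) ^ Suc j * (\<Sum>l\<le>N. of_nat ((j + l) choose l) * w ^ l) - 1)
      - (1 - w) ^ Suc j * of_nat ((Suc j + N) choose N) * w ^ Suc N"
    unfolding step by (simp add: algebra_simps del: power_Suc)
  finally show ?case using Suc by (simp only:) (rule dvd_diff[OF _ dvd_triv_right])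
qed

text \<open>A column of Pascal's triangle, that is X^q / (1 - X)^(q+1). Over the integers it is
  handled through its products with powers of 1 - X instead of as a quotient.\<close>

definition binomial_fps :: "nat \<Rightarrow> int fps" where
  "binomial_fps q = Abs_fps (\<lambda>n. int (n choose q))"

lemma binomial_fps_0: "(1 - fps_X) * binomial_fps 0 = 1"
  by (rule fps_ext) (auto simp: binomial_fps_def algebra_simps)

lemma binomial_fps_Suc: "(1 - fps_X) * binomial_fps (Suc q) = fps_X * binomial_fps q"
proof (rule fps_ext)
  fix n
  show "((1 - fps_X) * binomial_fps (Suc q)) $ n = (fps_X * binomial_fps q) $ n"
    by (cases n) (auto simp: binomial_fps_def algebra_simps)
qed

lemma binomial_fps_add: "(1 - fps_X) ^ p * binomial_fps (q + p) = fps_X ^ p * binomial_fps q"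
proof (induction p)
  case (Suc p)
  have "(1 - fps_X) ^ Suc p * binomial_fps (q + Suc p)
      = (1 - fps_X) ^ p * ((1 - fps_X) * binomial_fps (Suc (q + p)))"
    by (simp add: mult_ac)
  also have "\<dots> = fps_X * ((1 - fps_X) ^ p * binomial_fps (q + p))"
    by (simp only: binomial_fps_Suc mult_ac)
  also have "\<dots> = fps_X ^ Suc p * binomial_fps q" unfolding Suc.IH by (simp add: mult_ac)
  finally show ?case .
qed simp

text \<open>Without the cut-off M the sum would be (-X)^(p j) (1 - X)^(p-1) / ((1 - X)^p -
  (-X)^p)^(j+1). The cut-off keeps it finite and does not change coefficients below X^M when p >
  0.\<close>

definition multisection_fps :: "nat \<Rightarrow> nat \<Rightarrow> nat \<Rightarrow> int fps" where
  "multisection_fps p M j = (\<Sum>i<M. of_int ((-1) ^ (p * i) * int (i choose j)) * binomial_fps (p * i))"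

lemma multisection_fps_nth:
  "multisection_fps p M j $ n = (\<Sum>i<M. (-1) ^ (p * i) * int (i choose j) * int (n choose (p * i)))"
  unfolding multisection_fps_def fps_sum_nth of_int_mult_fps_nth by (simp add: binomial_fps_def)

text \<open>The extra term i = M starts only at X^(p M), and p M \<ge> M.\<close>

lemma multisection_fps_Suc_dvd:
  assumes "p > 0"
  shows "fps_X ^ M dvd multisection_fps p (Suc M) j - multisection_fps p M j"
proof -
  have "n < p * M" if "n < M" for n using assms that
    by (metis le_add1 less_le_trans mult_eq_if not_gr_zero mult.commute)
  then show ?thesis
    by (auto simp: fps_X_power_dvd_iff multisection_fps_nth binomial_eq_0)
qed

text \<open>Multiplication by (1 - X)^p lowers each column index p (i + 1) to p i at the price of
  X^p. The term i = 0 has no such predecessor; it is present only for j = 0 and gives (1 -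
  X)^(p-1).\<close>

lemma one_minus_X_power_mult_multisection_fps:
  assumes "p > 0"
  shows "(1 - fps_X) ^ p * multisection_fps p (Suc M) j
    = (if j = 0 then (1 - fps_X) ^ (p - 1) else 0)
      + (- fps_X) ^ p * (\<Sum>i<M. of_int ((-1) ^ (p * i) * int (Suc i choose j)) * binomial_fps (p * i))"
proof -
  have 0: "(1 - fps_X) ^ p * binomial_fps 0 = (1 - fps_X) ^ (p - 1)"
    using assms binomial_fps_0 by (cases p) (simp_all add: mult.assoc power_Suc2 del: power_Suc)
  have 1: "(1 - fps_X) ^ p * (of_int ((-1) ^ (p * Suc i) * int (Suc i choose j)) * binomial_fps (p * Suc i))
      = (- fps_X) ^ p * (of_int ((-1) ^ (p * i) * int (Suc i choose j)) * binomial_fps (p * i))" for i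
  proof -
    have "(1 - fps_X) ^ p * (of_int ((-1) ^ (p * Suc i) * int (Suc i choose j)) * binomial_fps (p * Suc i))
        = of_int ((-1) ^ (p * Suc i) * int (Suc i choose j)) * ((1 - fps_X) ^ p * binomial_fps (p * i + p))"
      by (simp add: mult_ac add.commute)
    also have "\<dots> = of_int ((-1) ^ (p * Suc i) * int (Suc i choose j)) * (fps_X ^ p * binomial_fps (p * i))"
      by (simp only: binomial_fps_add)
    also have "\<dots> = (- fps_X) ^ p * (of_int ((-1) ^ (p * i) * int (Suc i choose j)) * binomial_fps (p * i))"
      by (simp add: power_add power_minus[of fps_X] mult_ac)
    finally show ?thesis .
  qed
  show ?thesis
    unfolding multisection_fps_def sum.lessThan_Suc_shift distrib_left
    unfolding sum_distrib_left 1
    using 0 by (auto simp: sum_distrib_left)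
qed

text \<open>Write D for (1 - X)^p - (-X)^p and F_j for the series. Pascal's rule for
  \<open>Suc i choose Suc j\<close> turns the previous relation into D F_(j+1) = (-X)^p F_j modulo
  X^M, and D F_0 = (1 - X)^(p-1) starts the induction.\<close>

lemma multisection_fps_dvd:
  assumes "p > 0"
  shows "fps_X ^ M dvd ((1 - fps_X) ^ p - (- fps_X) ^ p) ^ Suc j * multisection_fps p M j
    - ((- fps_X) ^ p) ^ j * (1 - fps_X) ^ (p - 1)"
proof (induction j)
  case 0
  let ?F = "\<lambda>M. multisection_fps p M 0"
  have "((1 - fps_X) ^ p - (- fps_X) ^ p) * ?F M - (1 - fps_X) ^ (p - 1)
      = - ((1 - fps_X) ^ p * (?F (Suc M) - ?F M))"
    using one_minus_X_power_mult_multisection_fps[OF assms, of M 0]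
    by (simp add: multisection_fps_def[of p M] algebra_simps)
  then show ?case using multisection_fps_Suc_dvd[OF assms, of M 0] by simp
next
  case (Suc j)
  let ?F = "\<lambda>M j. multisection_fps p M j"
  let ?D = "(1 - fps_X) ^ p - (- fps_X) ^ p :: int fps"
  have "(\<Sum>i<M. of_int ((-1) ^ (p * i) * int (Suc i choose Suc j)) * binomial_fps (p * i))
      = ?F M j + ?F M (Suc j)"
    by (simp add: multisection_fps_def algebra_simps flip: sum.distrib)
  then have "?D * ?F M (Suc j) - (- fps_X) ^ p * ?F M j
      = - ((1 - fps_X) ^ p * (?F (Suc M) (Suc j) - ?F M (Suc j)))"
    using one_minus_X_power_mult_multisection_fps[OF assms, of M "Suc j"]
    by (simp add: algebra_simps)
  then have *: "fps_X ^ M dvd ?D * ?F M (Suc j) - (- fps_X) ^ p * ?F M j"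
    using multisection_fps_Suc_dvd[OF assms, of M "Suc j"] by simp
  have "?D ^ Suc (Suc j) * ?F M (Suc j) - ((- fps_X) ^ p) ^ Suc j * (1 - fps_X) ^ (p - 1)
      = ?D ^ Suc j * (?D * ?F M (Suc j) - (- fps_X) ^ p * ?F M j)
        + (- fps_X) ^ p * (?D ^ Suc j * ?F M j - ((- fps_X) ^ p) ^ j * (1 - fps_X) ^ (p - 1))"
  proof -
    have "d ^ Suc (Suc j) * a - z ^ Suc j * u
        = d ^ Suc j * (d * a - z * b) + z * (d ^ Suc j * b - z ^ j * u)" for d a z b u :: "int fps"
      by (simp add: algebra_simps)
    then show ?thesis .
  qed
  then show ?case using Suc * by (simp only:) (intro dvd_add dvd_mult)
qed

text \<open>The inner binomial coefficients of (1 - X)^p are multiples of p. That X divides q makes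
  the expansion in powers of p q converge X-adically; the degree bound on q later decides which
  powers can reach X^N.\<close>

lemma one_minus_X_power_prime:
  assumes p: "prime p"
  obtains q :: "int fps" where
    "(1 - fps_X) ^ p - (- fps_X) ^ p = 1 - of_nat p * q" "fps_X dvd q" "\<And>n. n > p - 1 \<Longrightarrow> q $ n = 0"
proof
  let ?q = "- (\<Sum>t\<in>{1..<p}. of_nat ((p choose t) div p) * (- fps_X) ^ t) :: int fps"
  have p0: "p > 0" using p by (rule prime_gt_0_nat)
  have "(1 - fps_X) ^ p = (\<Sum>t\<le>p. of_nat (p choose t) * (- fps_X :: int fps) ^ t)"
    using binomial_ring[of "- fps_X :: int fps" 1 p] by simp
  also have "{..p} = insert 0 (insert p {1..<p})" using p0 by auto
  also have "(\<Sum>t\<in>\<dots>. of_nat (p choose t) * (- fps_X :: int fps) ^ t)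
      = 1 + (- fps_X) ^ p + (\<Sum>t\<in>{1..<p}. of_nat (p choose t) * (- fps_X) ^ t)"
    using p0 by (simp add: add.assoc)
  also have "(\<Sum>t\<in>{1..<p}. of_nat (p choose t) * (- fps_X :: int fps) ^ t)
      = (\<Sum>t\<in>{1..<p}. of_nat p * (of_nat ((p choose t) div p) * (- fps_X) ^ t))"
  proof (rule sum.cong[OF refl])
    fix t assume "t \<in> {1..<p}"
    then have "p dvd p choose t" using p by (intro dvd_choose_prime) auto
    then have "p choose t = p * ((p choose t) div p)" by simp
    then show "of_nat (p choose t) * (- fps_X :: int fps) ^ t
        = of_nat p * (of_nat ((p choose t) div p) * (- fps_X) ^ t)"
      by (metis of_nat_mult mult.assoc)
  qed
  also have "\<dots> = - (of_nat p * ?q)" by (simp add: sum_distrib_left)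
  finally show "(1 - fps_X) ^ p - (- fps_X) ^ p = 1 - of_nat p * ?q" by simp
  have "fps_X dvd (- fps_X :: int fps) ^ t" if "t \<ge> 1" for t
    using that by (cases t) auto
  then show "fps_X dvd ?q"
    by (intro dvd_minus_iff[THEN iffD2] dvd_sum dvd_mult) auto
  have nth: "(- fps_X :: int fps) ^ t $ n = (if n = t then (-1) ^ t else 0)" for t n
  proof -
    have "(- fps_X :: int fps) ^ t = of_int ((-1) ^ t) * fps_X ^ t" by (simp add: power_minus[of fps_X])
    then show ?thesis by (simp only: of_int_mult_fps_nth) simp
  qed
  have "(of_nat c * f :: int fps) $ n = int c * f $ n" for c n f
    using of_int_mult_fps_nth[of "int c" f n] by simp
  then show "?q $ n = 0" if "n > p - 1" for n
    using that by (auto simp: fps_sum_nth nth intro!: sum.neutral)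
qed

text \<open>The negative binomial series for w = p q; since X divides q, powers beyond the M-th do
  not affect coefficients below X^M.\<close>

lemma multisection_fps_expansion:
  assumes p: "p > 0" and q: "(1 - fps_X) ^ p - (- fps_X) ^ p = 1 - of_nat p * q" "fps_X dvd q"
  shows "fps_X ^ M dvd multisection_fps p M j
    - (\<Sum>l\<le>M. of_int (int ((j + l) choose l) * int p ^ l) * (((- fps_X) ^ p) ^ j * (1 - fps_X) ^ (p - 1) * q ^ l))"
proof -
  define D E F G :: "int fps" where "D = 1 - of_nat p * q"
    and "E = (\<Sum>l\<le>M. of_nat ((j + l) choose l) * (of_nat p * q) ^ l)"
    and "F = multisection_fps p M j" and "G = ((- fps_X) ^ p) ^ j * (1 - fps_X) ^ (p - 1)"
  have "fps_X ^ M dvd (of_nat p * q) ^ M" by (intro dvd_power_same dvd_mult q)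
  also have "\<dots> dvd (of_nat p * q) ^ Suc M" by (simp add: le_imp_power_dvd del: power_Suc)
  also have "\<dots> dvd D ^ Suc j * E - 1"
    unfolding D_def E_def by (rule one_minus_power_negative_binomial_dvd)
  finally have 1: "fps_X ^ M dvd D ^ Suc j * E - 1" .
  have 2: "fps_X ^ M dvd D ^ Suc j * F - G"
    using multisection_fps_dvd[OF p, of M j] unfolding q(1) D_def F_def G_def .
  \<comment> \<open>With D^(j+1) E = 1 and D^(j+1) F = G modulo X^M this yields F = G E without
    inverting D.\<close>
  have "F - G * E = E * (D ^ Suc j * F - G) - F * (D ^ Suc j * E - 1)"
    by (simp add: algebra_simps del: power_Suc)
  then have "fps_X ^ M dvd F - G * E"
    using 1 2 by (simp add: dvd_diff)
  moreover have "G * E = (\<Sum>l\<le>M. of_int (int ((j + l) choose l) * int p ^ l) * (G * q ^ l))"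
    unfolding E_def sum_distrib_left by (intro sum.cong) (simp_all add: power_mult_distrib mult_ac)
  ultimately show ?thesis unfolding F_def G_def by simp
qed

subsection \<open>Partial Stirling sums\<close>

lemma neg_X_power_mult_one_minus_X_power_nth:
  "(((- fps_X) ^ p) ^ j * (1 - fps_X) ^ a :: int fps) $ (p * j + r) = (-1) ^ (p * j) * (-1) ^ r * int (a choose r)"
proof -
  have neg: "(- fps_X :: int fps) ^ t = of_int ((-1) ^ t) * fps_X ^ t" for t
    by (simp add: power_minus[of fps_X])
  have "(1 - fps_X :: int fps) ^ a = (\<Sum>t\<le>a. of_int (int (a choose t) * (-1) ^ t) * fps_X ^ t)"
    using binomial_ring[of "- fps_X :: int fps" 1 a] by (simp add: neg mult.assoc)
  then have "(1 - fps_X :: int fps) ^ a $ r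
      = (\<Sum>t\<le>a. int (a choose t) * (-1) ^ t * (if r = t then 1 else 0))"
    by (simp only: fps_sum_nth of_int_mult_fps_nth fps_X_power_nth)
  also have "\<dots> = (\<Sum>t\<le>a. if r = t then int (a choose t) * (-1) ^ t else 0)"
    by (intro sum.cong) auto
  also have "\<dots> = (-1) ^ r * int (a choose r)" by (subst sum.delta') (auto simp: binomial_eq_0)
  finally show ?thesis
    unfolding power_mult[symmetric] unfolding neg mult.assoc of_int_mult_fps_nth fps_X_power_mult_nth
    by simp
qed

text \<open>Neighbouring entries of row p - 1 add up to an entry of row p that is divisible by p, so
  they alternate in sign modulo p, starting from 1.\<close>

lemma prime_minus_one_choose_cong:
  assumes p: "prime p" and "r < p"
  shows "[(-1) ^ r * int ((p - 1) choose r) = 1] (mod int p)"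
  using \<open>r < p\<close>
proof (induction r)
  case (Suc r)
  have "p dvd p choose Suc r" using p Suc.prems by (intro dvd_choose_prime) auto
  moreover have "p choose Suc r = ((p - 1) choose r) + ((p - 1) choose Suc r)"
    using Suc.prems by (cases p) auto
  ultimately have "int p dvd int ((p - 1) choose r) + int ((p - 1) choose Suc r)"
    by (metis int_dvd_int_iff of_nat_add)
  then have "int p dvd (-1) ^ r * (int ((p - 1) choose r) + int ((p - 1) choose Suc r))" by simp
  then have "[(-1) ^ r * int ((p - 1) choose r) = (-1) ^ Suc r * int ((p - 1) choose Suc r)] (mod int p)"
    by (simp add: cong_iff_dvd_diff algebra_simps)
  then show ?case using Suc by (meson Suc_lessD cong_sym cong_trans)
qed simp

text \<open>The l-th term of the expansion is j! C(j+l,l) p^l times a coefficient of a polynomial.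
  Either that polynomial has degree below N, or m \<le> j + l; in the latter case a term with l > 0
  vanishes modulo the stated power. For l = 0 only j = m is left.\<close>

lemma fact_mult_multisection_cong:
  assumes p: "prime p" and m: "m = N div p" and j: "j \<le> m"
  shows "[fact j * (\<Sum>i\<le>N. (-1) ^ (p * i) * int (i choose j) * int (N choose (p * i)))
    = (if j = m then (-1) ^ (p * m) * fact m else 0)] (mod int p ^ Suc (multiplicity p (fact m :: nat)))"
    (is "[_ = ?rhs] (mod ?P)")
proof -
  obtain q :: "int fps" where q: "(1 - fps_X) ^ p - (- fps_X) ^ p = 1 - of_nat p * q"
      "fps_X dvd q" "\<And>n. n > p - 1 \<Longrightarrow> q $ n = 0"
    using one_minus_X_power_prime[OF p] by blast
  have p0: "p > 0" using p by (rule prime_gt_0_nat)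
  define g where "g l = (((- fps_X) ^ p) ^ j * (1 - fps_X) ^ (p - 1) * q ^ l) $ N" for l
  define r where "r = N mod p"
  have N: "N = p * m + r" and r: "r < p" using p0 by (simp_all add: m r_def)
  \<comment> \<open>The cut-off \<open>Suc N\<close> is the least for which the congruence modulo
    X^M covers the coefficient of X^N.\<close>
  have "multisection_fps p (Suc N) j $ N = (\<Sum>l\<le>Suc N. int ((j + l) choose l) * int p ^ l * g l)"
    using multisection_fps_expansion[OF p0 q(1,2), of "Suc N" j]
    unfolding fps_X_power_dvd_iff g_def
    by (simp only: fps_sub_nth fps_sum_nth of_int_mult_fps_nth right_minus_eq)
  then have "fact j * (\<Sum>i\<le>N. (-1) ^ (p * i) * int (i choose j) * int (N choose (p * i)))
      = (\<Sum>l\<le>Suc N. int (fact j * ((j + l) choose l) * p ^ l) * g l)"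
    by (simp only: multisection_fps_nth lessThan_Suc_atMost sum_distrib_left of_nat_mult of_nat_power
        of_nat_fact mult.assoc)
  also have "[(\<Sum>l\<le>Suc N. int (fact j * ((j + l) choose l) * p ^ l) * g l)
      = (\<Sum>l\<le>Suc N. if l = 0 then ?rhs else 0)] (mod ?P)"
  proof (rule cong_sum)
    fix l assume "l \<in> {..Suc N}"
    \<comment> \<open>The bound is the degree p j + (p - 1) + (p - 1) l of the product defining
      \<open>g l\<close>.\<close>
    have g0: "g l = 0" if "N > p * j + (p - 1) * Suc l"
    proof -
      have X: "((- fps_X :: int fps) ^ p) ^ j $ n = 0" if "n > p * j" for n
        using neg_X_power_mult_one_minus_X_power_nth[of p j 0 "n - p * j"] that by (simp add: binomial_eq_0)
      have Y: "(1 - fps_X :: int fps) ^ (p - 1) $ n = 0" if "n > p - 1" for n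
        using neg_X_power_mult_one_minus_X_power_nth[of p 0 "p - 1" n] that by (simp add: binomial_eq_0)
      show ?thesis unfolding g_def
      proof (rule fps_nth_mult_eq_0)
        show "(((- fps_X :: int fps) ^ p) ^ j * (1 - fps_X) ^ (p - 1)) $ n = 0" if "n > p * j + (p - 1)" for n
          using X Y that by (rule fps_nth_mult_eq_0)
        show "q ^ l $ n = 0" if "n > (p - 1) * l" for n
          using q(3) that by (rule fps_nth_power_eq_0)
      qed (use that in simp)
    qed
    \<comment> \<open>Otherwise p j + p (l + 1) \<le> p m \<le> N, which is beyond the degree
      bound.\<close>
    have large: "m \<le> j + l" if "N \<le> p * j + (p - 1) * Suc l"
    proof (rule ccontr)
      assume "\<not> m \<le> j + l"
      then have "j + Suc l \<le> m" by simp
      then have "p * (j + Suc l) \<le> p * m" by (rule mult_le_mono2)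
      moreover have "(p - 1) * Suc l < p * Suc l" using p0 by (intro mult_strict_right_mono) auto
      ultimately show False using that N by (simp only: distrib_left)
    qed
    show "[int (fact j * ((j + l) choose l) * p ^ l) * g l = (if l = 0 then ?rhs else 0)] (mod ?P)"
    proof (cases "l = 0")
      case False
      have "?P dvd int (fact j * ((j + l) choose l) * p ^ l) * g l"
      proof (cases "N > p * j + (p - 1) * Suc l")
        case False
        then have "p ^ Suc (multiplicity p (fact m :: nat)) dvd fact j * ((j + l) choose l) * p ^ l"
          using p \<open>l \<noteq> 0\<close> large by (intro prime_power_dvd_fact_choose) auto
        then show ?thesis by (metis dvd_mult2 int_dvd_int_iff of_nat_power)
      qed (simp add: g0)
      then show ?thesis using False by (simp add: cong_0_iff)
    next
      case True
      show ?thesis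
      proof (cases "j = m")
        case False
        then have "\<not> m \<le> j + l" using True j by simp
        then have "g l = 0" using g0 large by linarith
        then show ?thesis using True False by simp
      next
        case jm: True
        have g: "g 0 = (-1) ^ (p * m) * ((-1) ^ r * int ((p - 1) choose r))"
          unfolding g_def N jm by (simp add: neg_X_power_mult_one_minus_X_power_nth)
        \<comment> \<open>The binomial factor is 1 only modulo p; the p-part of m! lifts this to the
          full modulus.\<close>
        have "int p ^ multiplicity p (fact m :: nat) dvd fact m"
          by (metis multiplicity_dvd of_nat_dvd_iff of_nat_fact of_nat_power)
        moreover have "int p dvd (-1) ^ r * int ((p - 1) choose r) - 1"
          using prime_minus_one_choose_cong[OF p r] by (simp add: cong_iff_dvd_diff)
        ultimately have "int p ^ multiplicity p (fact m :: nat) * int p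
            dvd fact m * ((-1) ^ r * int ((p - 1) choose r) - 1)"
          by (rule mult_dvd_mono)
        then have "?P dvd (-1) ^ (p * m) * (fact m * ((-1) ^ r * int ((p - 1) choose r) - 1))"
          by (simp only: power_Suc2 dvd_mult)
        then show ?thesis using True jm by (simp add: g cong_iff_dvd_diff algebra_simps)
      qed
    qed
  qed
  also have "(\<Sum>l\<le>Suc N. if l = 0 then ?rhs else 0) = ?rhs" by (subst sum.delta) auto
  finally show ?thesis .
qed

text \<open>Only the term \<open>j = m\<close> of the expansion of \<open>i\<^sup>k\<close> in binomial coefficients survives.\<close>

lemma alternating_sum_choose_prime_mult_cong:
  assumes p: "prime p" and m: "m = N div p"
  shows "[(\<Sum>i\<le>N. (-1) ^ (p * i) * int (N choose (p * i)) * int i ^ k)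
    = (-1) ^ (p * m) * fact m * int (Stirling k m)] (mod int p ^ Suc (multiplicity p (fact m :: nat)))"
    (is "[_ = _] (mod ?P)")
proof -
  have p0: "p > 0" using p by (rule prime_gt_0_nat)
  define A where "A j = fact j * (\<Sum>i\<le>N. (-1) ^ (p * i) * int (i choose j) * int (N choose (p * i)))" for j
  have A: "[A j = (if j = m then (-1) ^ (p * m) * fact m else 0)] (mod ?P)" for j
  proof (cases "j \<le> m")
    case False
    \<comment> \<open>A nonzero product would require j \<le> i and p i \<le> N, hence j \<le>
      m.\<close>
    have "(i choose j) * (N choose (p * i)) = 0" for i
    proof (cases "i \<le> m")
      case True
      then show ?thesis using False by (simp add: binomial_eq_0)
    next
      case False
      then have "N < p * i" using p0 m by (metis div_less_iff_less_mult mult.commute not_le)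
      then show ?thesis by (simp add: binomial_eq_0)
    qed
    then have "(-1) ^ (p * i) * int (i choose j) * int (N choose (p * i)) = 0" for i
      by (metis mult_eq_0_iff of_nat_eq_0_iff)
    then have "A j = 0" by (simp only: A_def sum.neutral_const mult_zero_right)
    then show ?thesis using False by simp
  qed (unfold A_def, rule fact_mult_multisection_cong[OF p m])
  have "(\<Sum>i\<le>N. (-1) ^ (p * i) * int (N choose (p * i)) * int i ^ k)
      = (\<Sum>i\<le>N. \<Sum>j\<le>k. int (Stirling k j) * (fact j * ((-1) ^ (p * i) * int (i choose j) * int (N choose (p * i)))))"
    by (simp add: power_eq_sum_Stirling sum_distrib_left mult_ac flip: of_nat_power)
  also have "\<dots> = (\<Sum>j\<le>k. int (Stirling k j) * A j)"
    unfolding A_def by (subst sum.swap) (simp add: sum_distrib_left)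
  also have "[(\<Sum>j\<le>k. int (Stirling k j) * A j)
      = (\<Sum>j\<le>k. int (Stirling k j) * (if j = m then (-1) ^ (p * m) * fact m else 0))] (mod ?P)"
    by (intro cong_sum cong_mult A cong_refl)
  also have "(\<Sum>j\<le>k. int (Stirling k j) * (if j = m then (-1) ^ (p * m) * fact m else 0))
      = (-1) ^ (p * m) * fact m * int (Stirling k m)"
    by (auto simp: if_distrib cong: if_cong)
  finally show ?thesis .
qed

subsection \<open>Valuations of Stirling numbers\<close>

text \<open>Euler's theorem for the modulus p^(L+1) if p does not divide i; otherwise the exponent
  is at least 2^L \<ge> L + 1.\<close>

lemma power_totient_prime_power_cong:
  assumes p: "prime p"
  shows "[int i ^ ((p - 1) * p ^ L) = (if p dvd i then 0 else 1)] (mod int p ^ Suc L)"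
proof (cases "p dvd i")
  case True
  have "Suc L \<le> 2 ^ L" by (induction L) auto
  also have "\<dots> \<le> p ^ L" using p by (intro power_mono prime_ge_2_nat) auto
  also have "\<dots> \<le> (p - 1) * p ^ L" using prime_ge_2_nat[OF p] by simp
  finally have "int p ^ Suc L dvd int p ^ ((p - 1) * p ^ L)" by (rule le_imp_power_dvd)
  also have "\<dots> dvd int i ^ ((p - 1) * p ^ L)" using True by (intro dvd_power_same) simp
  finally show ?thesis using True by (simp add: cong_0_iff)
next
  case False
  then have "coprime i p" using p by (metis coprime_commute prime_imp_coprime)
  then have "coprime i (p ^ Suc L)" by simp
  then have "[i ^ totient (p ^ Suc L) = 1] (mod p ^ Suc L)" by (rule euler_theorem)
  also have "totient (p ^ Suc L) = (p - 1) * p ^ L"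
    by (subst totient_prime_power[OF p]) (auto simp: mult.commute)
  finally have "[int (i ^ ((p - 1) * p ^ L)) = int 1] (mod int (p ^ Suc L))"
    by (simp only: cong_int_iff)
  then show ?thesis using False by simp
qed

lemma sum_multiples_eq:
  fixes f :: "nat \<Rightarrow> int"
  assumes p: "p > 0" and f: "\<And>i. i > N \<Longrightarrow> f i = 0"
  shows "(\<Sum>i\<le>N. if p dvd i then f i else 0) = (\<Sum>i\<le>N. f (p * i))"
proof -
  have "(\<Sum>i\<le>N. f (p * i)) = (\<Sum>i\<in>((*) p) ` {..N}. f i)"
    using p by (subst sum.reindex) (auto simp: inj_on_def)
  also have "\<dots> = (\<Sum>i\<in>{i. i \<le> N \<and> p dvd i}. f i)"
  proof (rule sum.mono_neutral_right)
    show "{i. i \<le> N \<and> p dvd i} \<subseteq> (*) p ` {..N}"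
    proof
      fix i assume "i \<in> {i. i \<le> N \<and> p dvd i}"
      then obtain c where "i = p * c" "p * c \<le> N" by auto
      moreover have "c \<le> p * c" using p by simp
      ultimately have "c \<in> {..N}" by (metis atMost_iff le_trans)
      then show "i \<in> (*) p ` {..N}" using \<open>i = p * c\<close> by (intro image_eqI)
    qed
    show "\<forall>i \<in> (*) p ` {..N} - {i. i \<le> N \<and> p dvd i}. f i = 0"
    proof
      fix i assume "i \<in> (*) p ` {..N} - {i. i \<le> N \<and> p dvd i}"
      then have "N < i" by auto
      then show "f i = 0" by (rule f)
    qed
  qed simp
  also have "\<dots> = (\<Sum>i\<le>N. if p dvd i then f i else 0)"
    by (subst sum.inter_filter[symmetric]) auto
  finally show ?thesis ..
qed

text \<open>Modulo the stated power, i^((p-1) p^L) is the indicator of the i prime to p. Since k <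
  N, the sum over all i is zero, so what remains is minus the sum over multiples of p, from which
  p^k is taken out.\<close>

lemma fact_mult_Stirling_cong:
  assumes p: "prime p" and k: "k < N" and m: "m = N div p"
    and L: "k + multiplicity p (fact m :: nat) \<le> L"
  shows "[(-1) ^ N * fact N * int (Stirling ((p - 1) * p ^ L + k) N)
    = - (int p ^ k * ((-1) ^ (p * m) * fact m * int (Stirling k m)))]
      (mod int p ^ Suc (k + multiplicity p (fact m :: nat)))"
    (is "[_ = _] (mod ?P)")
proof -
  let ?v = "multiplicity p (fact m :: nat)"
  let ?f = "\<lambda>i. (-1) ^ i * int (N choose i) * int i ^ k"
  have p0: "p > 0" using p by (rule prime_gt_0_nat)
  have PL: "?P dvd int p ^ Suc L" using L by (intro le_imp_power_dvd) simp
  have "(-1) ^ N * fact N * int (Stirling ((p - 1) * p ^ L + k) N)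
      = (\<Sum>i\<le>N. (-1) ^ i * int (N choose i) * int i ^ ((p - 1) * p ^ L + k))"
    by (rule alternating_sum_choose_power[symmetric])
  also have "\<dots> = (\<Sum>i\<le>N. int i ^ ((p - 1) * p ^ L) * ?f i)"
    by (simp add: power_add mult_ac)
  also have "[(\<Sum>i\<le>N. int i ^ ((p - 1) * p ^ L) * ?f i) = (\<Sum>i\<le>N. (if p dvd i then 0 else 1) * ?f i)] (mod ?P)"
    by (intro cong_sum cong_mult cong_refl cong_dvd_modulus[OF power_totient_prime_power_cong[OF p] PL])
  also have "(\<Sum>i\<le>N. (if p dvd i then 0 else 1) * ?f i) = (\<Sum>i\<le>N. ?f i - (if p dvd i then ?f i else 0))"
    by (intro sum.cong) auto
  also have "\<dots> = (\<Sum>i\<le>N. ?f i) - (\<Sum>i\<le>N. if p dvd i then ?f i else 0)"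
    by (rule sum_subtractf)
  also have "(\<Sum>i\<le>N. ?f i) = 0"
    using k by (simp add: alternating_sum_choose_power)
  also have "(\<Sum>i\<le>N. if p dvd i then ?f i else 0) = (\<Sum>i\<le>N. ?f (p * i))"
    using p0 by (rule sum_multiples_eq) (simp add: binomial_eq_0)
  also have "\<dots> = int p ^ k * (\<Sum>i\<le>N. (-1) ^ (p * i) * int (N choose (p * i)) * int i ^ k)"
    unfolding sum_distrib_left by (intro sum.cong refl) (simp add: power_mult_distrib)
  also have "0 - int p ^ k * (\<Sum>i\<le>N. (-1) ^ (p * i) * int (N choose (p * i)) * int i ^ k)
      = - (int p ^ k * (\<Sum>i\<le>N. (-1) ^ (p * i) * int (N choose (p * i)) * int i ^ k))" by simp
  also have "[- (int p ^ k * (\<Sum>i\<le>N. (-1) ^ (p * i) * int (N choose (p * i)) * int i ^ k))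
      = - (int p ^ k * ((-1) ^ (p * m) * fact m * int (Stirling k m)))] (mod ?P)"
  \<comment> \<open>The extracted factor p^k raises the modulus of the previous congruence by k
    powers of p.\<close>
  proof -
    have "?P = int p ^ k * int p ^ Suc ?v" by (simp add: power_add)
    then show ?thesis
      unfolding cong_minus_minus_iff
      using cong_cmult_leftI[OF alternating_sum_choose_prime_mult_cong[OF p m, of k], of "int p ^ k"]
      by (simp only:)
  qed
  finally show ?thesis .
qed

lemma Stirling_pos: "Stirling n k > 0" if "k \<le> n" "k > 0"
  using that by (induction n k rule: Stirling.induct) (auto simp: le_Suc_eq)

text \<open>The valuation of N! is m plus that of m!. In the congruence between N! S(e+k,N) and p^k
  m! S(k,m), up to sign, the valuation of m! therefore cancels, and the remaining factor S(k,m)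
  decides equality.\<close>

lemma multiplicity_Stirling:
  assumes p: "prime p" and k: "k < N" and m: "m = N div p"
    and L: "k + N \<le> L"
  shows "multiplicity p (Stirling ((p - 1) * p ^ L + k) N) + m \<ge> k"
    and "multiplicity p (Stirling ((p - 1) * p ^ L + k) N) + m = k \<longleftrightarrow> \<not> p dvd Stirling k m"
proof -
  let ?v = "multiplicity p (fact m :: nat)"
  let ?S = "Stirling ((p - 1) * p ^ L + k) N"
  let ?R = "fact m * Stirling k m"
  have "?v \<le> m" using multiplicity_fact_less[OF p, of m] by (cases "m = 0") auto
  also have "m \<le> N" by (simp add: m)
  finally have "k + ?v \<le> L" using L by simp
  note cong = fact_mult_Stirling_cong[OF p k m this]
  \<comment> \<open>The exponents \<open>k + ?v\<close> and \<open>Suc (k + ?v)\<close> are the two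
    that matter: the first gives the inequality, the second the equality case.\<close>
  have dvd_iff: "p ^ e dvd fact N * ?S \<longleftrightarrow> p ^ e dvd p ^ k * ?R" if "e \<le> Suc (k + ?v)" for e
  proof -
    have "int p ^ e dvd int p ^ Suc (k + ?v)" using that by (rule le_imp_power_dvd)
    from cong_dvd_modulus[OF cong this] have
      "int p ^ e dvd (-1) ^ N * fact N * int ?S \<longleftrightarrow> int p ^ e dvd - (int p ^ k * ((-1) ^ (p * m) * fact m * int (Stirling k m)))"
      by (rule cong_dvd_iff)
    moreover have "int p ^ e dvd (-1) ^ N * fact N * int ?S \<longleftrightarrow> int p ^ e dvd int (fact N * ?S)"
      by (cases "even N") simp_all
    moreover have "int p ^ e dvd - (int p ^ k * ((-1) ^ (p * m) * fact m * int (Stirling k m)))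
        \<longleftrightarrow> int p ^ e dvd int (p ^ k * ?R)"
      by (cases "even (p * m)") (simp_all add: mult_ac)
    ultimately show ?thesis by (metis int_dvd_int_iff of_nat_power)
  qed
  have p0: "p > 0" "\<not> is_unit p" "prime_elem p" using p by (auto simp: prime_gt_0_nat)
  \<comment> \<open>Guarantees a nonzero Stirling number; \<open>multiplicity\<close> of 0 is 0 only
    by convention.\<close>
  have "N \<le> (p - 1) * p ^ L + k"
  proof -
    have "L < 2 ^ L" by (rule less_exp)
    also have "\<dots> \<le> p ^ L" using p by (intro power_mono prime_ge_2_nat) auto
    also have "\<dots> \<le> (p - 1) * p ^ L" using prime_ge_2_nat[OF p] by simp
    finally show ?thesis using L by simp
  qed
  then have S: "?S \<noteq> 0" using Stirling_pos[of N] k by simp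
  have v: "multiplicity p (fact N * ?S) = multiplicity p ?S + m + ?v"
    using S p0 by (subst prime_elem_multiplicity_mult_distrib) (auto simp: multiplicity_fact[OF p, of N] m)
  have iff: "p ^ e dvd fact N * ?S \<longleftrightarrow> e \<le> multiplicity p ?S + m + ?v" for e
    using S p0 v by (subst power_dvd_iff_le_multiplicity) auto
  have fact_m: "p ^ ?v dvd fact m" by (rule multiplicity_dvd)
  have "p ^ (k + ?v) dvd p ^ k * ?R" by (simp add: power_add mult_dvd_mono fact_m)
  then show ge: "multiplicity p ?S + m \<ge> k" using dvd_iff[of "k + ?v"] iff by simp
  have "p ^ Suc (k + ?v) dvd p ^ k * ?R \<longleftrightarrow> p dvd Stirling k m"
  proof -
    obtain u where u: "fact m = p ^ ?v * u" "\<not> p dvd u"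
      using p0 multiplicity_decompose'[of "fact m" p] by auto
    have "p ^ Suc (k + ?v) dvd p ^ k * ?R \<longleftrightarrow> p ^ (k + ?v) * p dvd p ^ (k + ?v) * (u * Stirling k m)"
      by (subst u(1)) (simp add: power_add mult_ac)
    also have "\<dots> \<longleftrightarrow> p dvd u * Stirling k m" using p0 by simp
    also have "\<dots> \<longleftrightarrow> p dvd Stirling k m" using p u(2) by (simp add: prime_dvd_mult_iff)
    finally show ?thesis .
  qed
  then have "p dvd Stirling k m \<longleftrightarrow> Suc k \<le> multiplicity p ?S + m"
    using dvd_iff[of "Suc (k + ?v)"] iff[of "Suc (k + ?v)"] by simp
  then show "multiplicity p ?S + m = k \<longleftrightarrow> \<not> p dvd Stirling k m" using ge by auto
qed

subsection \<open>Stirling numbers modulo 2 and 3\<close>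

text \<open>The recurrence in terms of the excess t of the upper over the lower argument, the
  variable in which the values modulo p are periodic enough to be described.\<close>

lemma Stirling_Suc_cong:
  assumes "[Suc k = c] (mod p)" "[Stirling (Suc k + t) (Suc k) = x] (mod p)"
    "[Stirling (k + Suc t) k = y] (mod p)"
  shows "[Stirling (Suc k + Suc t) (Suc k) = c * x + y] (mod p)"
proof -
  have "Stirling (Suc k + Suc t) (Suc k) = Suc k * Stirling (Suc k + t) (Suc k) + Stirling (k + Suc t) k"
    by simp
  then show ?thesis using assms by (simp only:) (intro cong_add cong_mult)
qed

text \<open>The generating function of S(k+t,k) in t is the product of 1/(1 - i x) over i \<le> k.
  Modulo 2 only odd i count, giving (1 - x)^(-a) for k = 2a and (1 - x)^(-a-1) for k = 2a + 1. The
  proof checks this through the recurrence.\<close>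

lemma Stirling_cong_2:
  notes Stirling.simps [simp del]
  shows
  "[Stirling (2 * a + t) (2 * a) = (t + a - 1) choose t] (mod 2)"
  "[Stirling (2 * a + 1 + t) (2 * a + 1) = (t + a) choose a] (mod 2)"
proof (induction a arbitrary: t)
  case 0
  case 1
  show ?case by (cases t) (auto simp: Stirling.simps binomial_eq_0)
next
  case 0
  case 2
  show ?case by simp
next
  case (Suc a)
  have even: "[Stirling (2 * Suc a + t) (2 * Suc a) = (t + Suc a - 1) choose t] (mod 2)" for t
  proof (cases t)
    case (Suc t')
    have "[Stirling (Suc (2 * a + 1) + Suc t') (Suc (2 * a + 1))
        = 0 * Stirling (Suc (2 * a + 1) + t') (Suc (2 * a + 1)) + ((Suc t' + a) choose a)] (mod 2)"
      by (rule Stirling_Suc_cong[OF _ cong_refl Suc.IH(2)]) (simp add: cong_0_iff)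
    moreover have "(Suc t' + a) choose a = (Suc t' + a) choose Suc t'"
      using binomial_symmetric[of a "Suc t' + a"] by simp
    ultimately show ?thesis using Suc by simp
  qed simp
  case 1
  show ?case by (rule even)
  case 2
  show ?case
  proof (induction t)
    case (Suc t)
    have "[Stirling (Suc (2 * Suc a) + Suc t) (Suc (2 * Suc a))
        = 1 * ((t + Suc a) choose Suc a) + ((Suc t + Suc a - 1) choose Suc t)] (mod 2)"
      by (rule Stirling_Suc_cong[OF _ _ even]) (use Suc in \<open>simp_all add: cong_def\<close>)
    also have "1 * ((t + Suc a) choose Suc a) + ((Suc t + Suc a - 1) choose Suc t)
        = (Suc t + Suc a) choose Suc a"
      using binomial_symmetric[of a "t + Suc a"] by simp
    finally show ?case by (simp only: Suc_eq_plus1)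
  qed simp
qed

text \<open>Modulo 3, (1 - x)(1 - 2x) is 1 - x^2. The generating functions for k = 3a, 3a + 1, 3a +
  2 are thus (1 - x^2)^(-a), (1 + x)(1 - x^2)^(-a-1) and (1 - x^2)^(-a-1), which explains the split
  by the parity of the excess.\<close>

lemma Stirling_cong_3:
  notes Stirling.simps [simp del]
  shows
  "[Stirling (3 * a + 2 * u) (3 * a) = (u + a - 1) choose u] (mod 3) \<and>
   [Stirling (3 * a + (2 * u + 1)) (3 * a) = 0] (mod 3)"
  "[Stirling (3 * a + 1 + 2 * u) (3 * a + 1) = (u + a) choose a] (mod 3) \<and>
   [Stirling (3 * a + 1 + (2 * u + 1)) (3 * a + 1) = (u + a) choose a] (mod 3)"
  "[Stirling (3 * a + 2 + 2 * u) (3 * a + 2) = (u + a) choose a] (mod 3) \<and>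
   [Stirling (3 * a + 2 + (2 * u + 1)) (3 * a + 2) = 0] (mod 3)"
proof -
  \<comment> \<open>The induction runs in a cycle: \<open>P0 a\<close> gives \<open>P1 a\<close>,
    which gives \<open>P2 a\<close>, which gives \<open>P0 (Suc a)\<close>.\<close>
  define P0 where "P0 a \<longleftrightarrow> (\<forall>u. [Stirling (3 * a + 2 * u) (3 * a) = (u + a - 1) choose u] (mod 3) \<and>
    [Stirling (3 * a + (2 * u + 1)) (3 * a) = 0] (mod 3))" for a
  define P1 where "P1 a \<longleftrightarrow> (\<forall>u. [Stirling (3 * a + 1 + 2 * u) (3 * a + 1) = (u + a) choose a] (mod 3) \<and>
    [Stirling (3 * a + 1 + (2 * u + 1)) (3 * a + 1) = (u + a) choose a] (mod 3))" for a
  define P2 where "P2 a \<longleftrightarrow> (\<forall>u. [Stirling (3 * a + 2 + 2 * u) (3 * a + 2) = (u + a) choose a] (mod 3) \<and>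
    [Stirling (3 * a + 2 + (2 * u + 1)) (3 * a + 2) = 0] (mod 3))" for a
  have 1: "P1 a" if "P0 a" for a
  proof -
    from that have e: "\<And>u. [Stirling (3 * a + 2 * u) (3 * a) = (u + a - 1) choose u] (mod 3)"
      and o: "\<And>u. [Stirling (3 * a + (2 * u + 1)) (3 * a) = 0] (mod 3)" by (auto simp: P0_def)
    have odd: "[Stirling (3 * a + 1 + (2 * u + 1)) (3 * a + 1) = (u + a) choose a] (mod 3)"
      if "[Stirling (3 * a + 1 + 2 * u) (3 * a + 1) = (u + a) choose a] (mod 3)" for u
      using Stirling_Suc_cong[of "3 * a" 1 3 "2 * u" "(u + a) choose a" 0] that o[of u]
      by (simp add: cong_def)
    have even: "[Stirling (3 * a + 1 + 2 * u) (3 * a + 1) = (u + a) choose a] (mod 3)" for u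
    proof (induction u)
      case (Suc u)
      have "[Stirling (Suc (3 * a) + Suc (2 * u + 1)) (Suc (3 * a))
          = 1 * ((u + a) choose a) + ((Suc u + a - 1) choose Suc u)] (mod 3)"
        by (rule Stirling_Suc_cong) (use odd[OF Suc] e[of "Suc u"] in \<open>simp_all add: cong_def\<close>)
      moreover have "((u + a) choose a) + ((u + a) choose Suc u) = (Suc u + a) choose a"
        using binomial_symmetric[of "Suc u" "u + a"] by (cases a) (simp_all add: binomial_eq_0)
      ultimately show ?case by simp
    qed simp
    show ?thesis unfolding P1_def using odd even by blast
  qed
  have 2: "P2 a" if "P1 a" for a
  proof -
    from that have e: "\<And>u. [Stirling (3 * a + 1 + 2 * u) (3 * a + 1) = (u + a) choose a] (mod 3)"
      and o: "\<And>u. [Stirling (3 * a + 1 + (2 * u + 1)) (3 * a + 1) = (u + a) choose a] (mod 3)"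
      by (auto simp: P1_def)
    have c: "[Suc (3 * a + 1) = 2] (mod 3)" by (simp add: cong_def) presburger
    have odd: "[Stirling (3 * a + 2 + (2 * u + 1)) (3 * a + 2) = 0] (mod 3)"
      if "[Stirling (3 * a + 2 + 2 * u) (3 * a + 2) = (u + a) choose a] (mod 3)" for u
    proof -
      have "[Stirling (Suc (3 * a + 1) + Suc (2 * u)) (Suc (3 * a + 1))
          = 2 * ((u + a) choose a) + ((u + a) choose a)] (mod 3)"
        by (rule Stirling_Suc_cong[OF c]) (use that o[of u] in \<open>simp_all add: cong_def\<close>)
      moreover have "[2 * ((u + a) choose a) + ((u + a) choose a) = 0] (mod 3)"
        unfolding cong_0_iff by simp
      ultimately show ?thesis by (simp add: cong_def)
    qed
    have even: "[Stirling (3 * a + 2 + 2 * u) (3 * a + 2) = (u + a) choose a] (mod 3)" for u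
    proof (induction u)
      case (Suc u)
      have "[Stirling (Suc (3 * a + 1) + Suc (2 * u + 1)) (Suc (3 * a + 1))
          = 2 * 0 + ((Suc u + a) choose a)] (mod 3)"
        by (rule Stirling_Suc_cong[OF c]) (use odd[OF Suc] e[of "Suc u"] in \<open>simp_all add: cong_def\<close>)
      then show ?case by simp
    qed simp
    show ?thesis unfolding P2_def using odd even by blast
  qed
  have 3: "P0 (Suc a)" if "P2 a" for a
  proof -
    from that have e: "\<And>u. [Stirling (3 * a + 2 + 2 * u) (3 * a + 2) = (u + a) choose a] (mod 3)"
      and o: "\<And>u. [Stirling (3 * a + 2 + (2 * u + 1)) (3 * a + 2) = 0] (mod 3)"
      by (auto simp: P2_def)
    have odd: "[Stirling (3 * Suc a + (2 * u + 1)) (3 * Suc a) = 0] (mod 3)" for u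
    proof -
      have "[Stirling (Suc (3 * a + 2) + Suc (2 * u)) (Suc (3 * a + 2))
          = 0 * Stirling (Suc (3 * a + 2) + 2 * u) (Suc (3 * a + 2)) + 0] (mod 3)"
        by (rule Stirling_Suc_cong[OF _ cong_refl]) (use o[of u] in \<open>simp_all add: cong_def\<close>)
      then show ?thesis by (simp add: numeral_eq_Suc)
    qed
    have even: "[Stirling (3 * Suc a + 2 * u) (3 * Suc a) = (u + Suc a - 1) choose u] (mod 3)" for u
    proof (cases u)
      case (Suc v)
      have "[Stirling (Suc (3 * a + 2) + Suc (2 * v + 1)) (Suc (3 * a + 2))
          = 0 * Stirling (Suc (3 * a + 2) + (2 * v + 1)) (Suc (3 * a + 2)) + ((u + a) choose a)] (mod 3)"
        by (rule Stirling_Suc_cong[OF _ cong_refl]) (use e[of u] Suc in \<open>simp_all add: cong_def\<close>)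
      moreover have "(u + a) choose a = (u + a) choose u"
        using binomial_symmetric[of a "u + a"] by simp
      ultimately show ?thesis using Suc by (simp add: numeral_eq_Suc)
    qed simp
    show ?thesis unfolding P0_def using odd even by blast
  qed
  have 0: "P0 0" unfolding P0_def
  proof
    fix u show "[Stirling (3 * 0 + 2 * u) (3 * 0) = (u + 0 - 1) choose u] (mod 3) \<and>
      [Stirling (3 * 0 + (2 * u + 1)) (3 * 0) = 0] (mod 3)" by (cases u) (auto simp: Stirling.simps binomial_eq_0)
  qed
  have P0: "P0 a" by (induction a) (auto intro: 0 1 2 3)
  show "[Stirling (3 * a + 2 * u) (3 * a) = (u + a - 1) choose u] (mod 3) \<and>
      [Stirling (3 * a + (2 * u + 1)) (3 * a) = 0] (mod 3)"
    using P0 unfolding P0_def by blast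
  show "[Stirling (3 * a + 1 + 2 * u) (3 * a + 1) = (u + a) choose a] (mod 3) \<and>
      [Stirling (3 * a + 1 + (2 * u + 1)) (3 * a + 1) = (u + a) choose a] (mod 3)"
    using 1[OF P0] unfolding P1_def by blast
  show "[Stirling (3 * a + 2 + 2 * u) (3 * a + 2) = (u + a) choose a] (mod 3) \<and>
      [Stirling (3 * a + 2 + (2 * u + 1)) (3 * a + 2) = 0] (mod 3)"
    using 2[OF 1[OF P0]] unfolding P2_def by blast
qed

subsection \<open>The digit condition\<close>

text \<open>Appending the digit c creates just one new pair of neighbours, c and the last digit of
  a.\<close>

lemma T_add_iff:
  assumes "c < 3"
  shows "3 * a + c \<in> T \<longleftrightarrow> c + a mod 3 < 3 \<and> a \<in> T"
proof -
  have split: "(\<forall>i. P i) \<longleftrightarrow> P 0 \<and> (\<forall>i. P (Suc i))" for P :: "nat \<Rightarrow> bool"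
    by (metis not0_implies_Suc)
  have "digit3 (3 * a + c) (Suc i) = digit3 a i" for i
    using assms by (simp add: digit3_def div_mult2_eq)
  moreover have "digit3 (3 * a + c) 0 = c" "digit3 a 0 = a mod 3"
    using assms by (auto simp: digit3_def)
  ultimately show ?thesis
    unfolding T_def mem_Collect_eq by (subst split) simp
qed

lemma zero_in_T: "0 \<in> T"
  by (simp add: T_def digit3_def)

lemma T_mult_3_iff: "3 * a \<in> T \<longleftrightarrow> a \<in> T"
  using T_add_iff[of 0 a] by simp

text \<open>Adding a to 3a + c in base 3 pairs each digit of 3a + c with its upper neighbour, and by
  Kummer the binomial is prime to 3 when no carry occurs. The proof peels off one digit by Lucas;
  the last digit e of a takes the place of c, hence the general c.\<close>

lemma choose_not_dvd_3_iff_T: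
  assumes "c < 3"
  shows "\<not> 3 dvd (4 * a + c) choose a \<longleftrightarrow> 3 * a + c \<in> T"
  using assms
proof (induction a arbitrary: c rule: less_induct)
  case (less a)
  show ?case
  proof (cases "a = 0")
    case True
    then show ?thesis using less.prems zero_in_T T_add_iff[of c 0] by simp
  next
    case False
    define b e where "b = a div 3" and "e = a mod 3"
    have a: "a = 3 * b + e" and e: "e < 3" and b: "b < a"
      using False by (auto simp: b_def e_def)
    have p: "prime (3 :: nat)" by simp
    show ?thesis
    proof (cases "e + c < 3")
      case True
      have "4 * a + c = 3 * (4 * b + e) + (e + c)" using a by simp
      then have "[(4 * a + c) choose a = ((4 * b + e) choose b) * ((e + c) choose e)] (mod 3)"
        using lucas_binomial[OF p True e, of "4 * b + e" b] by (simp only: a)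
      moreover have "\<not> 3 dvd (e + c) choose e"
      proof -
        have "e \<in> {0, 1, 2}" "c \<in> {0, 1, 2}" using e less.prems by auto
        moreover have "\<not> 3 dvd Suc (Suc 0)" by presburger
        ultimately show ?thesis using True by auto
      qed
      ultimately have "\<not> 3 dvd (4 * a + c) choose a \<longleftrightarrow> \<not> 3 dvd (4 * b + e) choose b"
        using p by (simp add: cong_dvd_iff prime_dvd_mult_iff)
      also have "\<dots> \<longleftrightarrow> a \<in> T" using less.IH[OF b e] a by simp
      also have "\<dots> \<longleftrightarrow> 3 * a + c \<in> T"
        using T_add_iff[OF less.prems] True by (simp add: e_def add.commute)
      finally show ?thesis .
    next
      case False
      have eq: "4 * a + c = 3 * (4 * b + e + 1) + (e + c - 3)" using a False by simp
      \<comment> \<open>A carry occurs; the last digit on top is smaller than e, so Lucas' factor is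
        zero.\<close>
      have lt: "e + c - 3 < e" "e + c - 3 < 3" using e less.prems False by auto
      have "[(4 * a + c) choose a = 0] (mod 3)"
        using lucas_binomial[OF p lt(2) e, of "4 * b + e + 1" b]
        by (simp only: eq a[symmetric] binomial_eq_0[OF lt(1)] mult_0_right)
      then have "3 dvd (4 * a + c) choose a" by (simp add: cong_0_iff)
      moreover have "3 * a + c \<notin> T"
        using T_add_iff[OF less.prems] False by (simp add: e_def add.commute)
      ultimately show ?thesis by simp
    qed
  qed
qed

section \<open>Divisibility of S(n-1,[n/p]) by p for p = 2 and p = 3\<close>

lemma choose_pred_eq: "n > 0 \<Longrightarrow> Suc k * n choose n = Suc k * ((Suc k * n - 1) choose (k * n))"
proof -
  assume n: "n > 0"
  have "n * (Suc k * n choose n) = Suc k * n * ((Suc k * n - 1) choose (n - 1))"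
    using binomial_absorption[of "n - 1" "Suc k * n"] n by simp
  also have "(Suc k * n - 1) choose (n - 1) = (Suc k * n - 1) choose (k * n)"
    using binomial_symmetric[of "n - 1" "Suc k * n - 1"] n by simp
  finally show ?thesis using n by (metis mult.assoc mult.left_commute nat_mult_eq_cancel1)
qed

lemma two_power_times_odd_unique:
  fixes n s t :: nat
  assumes "n = 2 * s + 1 \<or> n = 4 * s + 2 \<or> n = 8 * s + 4"
    and "n = 2 * t + 1 \<or> n = 4 * t + 2 \<or> n = 8 * t + 4"
  shows "t = s"
proof -
  have "2 * x + 1 \<noteq> 2 * y" for x y :: nat by presburger
  from this[of s "2 * t + 1"] this[of s "4 * t + 2"] this[of t "2 * s + 1"] this[of t "4 * s + 2"]
  show ?thesis using assms by (elim disjE) simp_all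
qed

text \<open>\<open>Stirling_cong_2\<close> gives a binomial coefficient, which Lucas reduces to
  C(3s,s) with 2s + 1 the odd part of n. The cases are n odd, n = 4a + 2, n = 8b + 4 and 8 dividing
  n.\<close>

lemma odd_Stirling_half_iff:
  notes Stirling.simps [simp del] binomial_Suc_Suc [simp del]
  assumes "n \<ge> 1"
  shows "odd (Stirling (n - 1) (n div 2)) \<longleftrightarrow>
    (\<exists>\<epsilon> s. \<epsilon> \<le> 2 \<and> n = 2 ^ \<epsilon> * (2 * s + 1) \<and> odd ((3 * s) choose s))" (is "_ \<longleftrightarrow> ?R")
proof -
  have le2: "\<epsilon> \<le> 2 \<longleftrightarrow> \<epsilon> = 0 \<or> \<epsilon> = 1 \<or> \<epsilon> = 2" for \<epsilon> :: nat by auto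
  have R: "?R \<longleftrightarrow> (\<exists>s. (n = 2 * s + 1 \<or> n = 4 * s + 2 \<or> n = 8 * s + 4) \<and> odd ((3 * s) choose s))"
  proof -
    have "?R \<longleftrightarrow> (\<exists>s. (n = 2 ^ 0 * (2 * s + 1) \<or> n = 2 ^ 1 * (2 * s + 1) \<or> n = 2 ^ 2 * (2 * s + 1))
        \<and> odd ((3 * s) choose s))"
      unfolding le2 by blast
    then show ?thesis by (simp add: add.commute)
  qed
  have R1: "?R \<longleftrightarrow> odd ((3 * s) choose s)" if "n = 2 * s + 1 \<or> n = 4 * s + 2 \<or> n = 8 * s + 4" for s
    unfolding R using that two_power_times_odd_unique[OF that] by blast
  have p: "prime (2 :: nat)" by simp
  define a where "a = n div 4"
  have "n = 4 * a \<or> n = 4 * a + 1 \<or> n = 4 * a + 2 \<or> n = 4 * a + 3"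
    unfolding a_def by presburger
  then consider "n = 4 * a + 1" | "n = 4 * a + 3" | "n = 4 * a + 2" | "n = 4 * a" "odd a"
    | "n = 4 * a" "even a" by blast
  then show ?thesis
  proof cases
    case 1
    \<comment> \<open>The two binomials differ by the factor 3, a unit modulo 2.\<close>
    have "odd ((2 * a + a - 1) choose (2 * a)) \<longleftrightarrow> odd ((3 * a) choose a)"
    proof (cases "a = 0")
      case False
      then have "(3 * a) choose a = 3 * ((2 * a + a - 1) choose (2 * a))"
        using choose_pred_eq[of a 2] by simp
      then show ?thesis by simp
    qed simp
    moreover have "[(3 * (2 * a)) choose (2 * a) = (3 * a) choose a] (mod 2)"
      using lucas_binomial[OF p, of 0 0 "3 * a" a] by simp
    moreover have "[Stirling (n - 1) (n div 2) = (2 * a + a - 1) choose (2 * a)] (mod 2)"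
      using Stirling_cong_2(1)[of a "2 * a"] 1 by simp
    ultimately show ?thesis using R1[of "2 * a"] 1 by (simp add: cong_dvd_iff)
  next
    case 2
    have "3 * (2 * a + 1) = 2 * (3 * a + 1) + 1" by simp
    then have "[(3 * (2 * a + 1)) choose (2 * a + 1) = (3 * a + 1) choose a] (mod 2)"
      using lucas_binomial[OF p, of 1 1 "3 * a + 1" a] by (simp only:) simp
    moreover have "n - 1 = 2 * a + 1 + (2 * a + 1)" "n div 2 = 2 * a + 1" using 2 by simp_all
    then have "[Stirling (n - 1) (n div 2) = (3 * a + 1) choose a] (mod 2)"
      using Stirling_cong_2(2)[of a "2 * a + 1"] by simp
    ultimately show ?thesis using R1[of "2 * a + 1"] 2 by (simp add: cong_dvd_iff)
  next
    case 3
    have "[Stirling (n - 1) (n div 2) = (3 * a) choose a] (mod 2)"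
      using Stirling_cong_2(2)[of a "2 * a"] 3 by simp
    then show ?thesis using R1[of a] 3 by (simp add: cong_dvd_iff)
  next
    case 4
    then obtain b where b: "a = 2 * b + 1" by (elim oddE)
    have "n - 1 = 2 * a + (4 * b + 1)" "n div 2 = 2 * a" using 4 b by simp_all
    moreover have "4 * b + 1 + a - 1 = 2 * (3 * b) + 1" "4 * b + 1 = 2 * (2 * b) + 1"
      using b by simp_all
    ultimately have "[Stirling (n - 1) (n div 2) = (2 * (3 * b) + 1) choose (2 * (2 * b) + 1)] (mod 2)"
      using Stirling_cong_2(1)[of a "4 * b + 1"] by (simp only:)
    also have "[(2 * (3 * b) + 1) choose (2 * (2 * b) + 1) = (3 * b) choose (2 * b)] (mod 2)"
      using lucas_binomial[OF p, of 1 1 "3 * b" "2 * b"] by simp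
    also have "(3 * b) choose (2 * b) = (3 * b) choose b"
      using binomial_symmetric[of b "3 * b"] by simp
    finally show ?thesis using R1[of b] 4 b by (simp add: cong_dvd_iff)
  next
    \<comment> \<open>Here n = 8 (b + 1). The last binary digits are 0 above and 1 below, so the
      binomial is even; and n has none of the three admissible shapes.\<close>
    case 5
    then obtain b where b: "a = 2 * Suc b" using assms by (metis evenE mult_0_right not0_implies_Suc not_one_le_zero)
    have "n - 1 = 2 * a + (4 * b + 3)" "n div 2 = 2 * a" using 5 b by simp_all
    moreover have "4 * b + 3 + a - 1 = 2 * (3 * b + 2) + 0" "4 * b + 3 = 2 * (2 * b + 1) + 1"
      using b by simp_all
    ultimately have "[Stirling (n - 1) (n div 2) = (2 * (3 * b + 2) + 0) choose (2 * (2 * b + 1) + 1)] (mod 2)"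
      using Stirling_cong_2(1)[of a "4 * b + 3"] by (simp only:)
    also have "[(2 * (3 * b + 2) + 0) choose (2 * (2 * b + 1) + 1) = 0] (mod 2)"
      using lucas_binomial[OF p, of 0 1 "3 * b + 2" "2 * b + 1"] by simp
    finally have "even (Stirling (n - 1) (n div 2))" by (simp add: cong_0_iff)
    moreover have "\<not> (n = 2 * s + 1 \<or> n = 4 * s + 2 \<or> n = 8 * s + 4)" for s
    proof -
      have "2 * x \<noteq> 2 * s + 1" for x by presburger
      from this[of "4 * Suc b"] this[of "2 * Suc b"] this[of "Suc b"] show ?thesis using 5 b by linarith
    qed
    then have "\<not> ?R" unfolding R by blast
    ultimately show ?thesis by simp
  qed
qed

text \<open>With n = 9a + 3c + r the lower argument is 3a + c and the excess is 6a + 2c + r - 1. For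
  c = 0 or c = 2 an odd excess, that is r \<noteq> 1, gives 0 modulo 3; the five other cases lead to
  C(4a,a), C(4a+1,a) or C(4a+2,a) up to a unit.\<close>

lemma Stirling_third_not_dvd_3_iff:
  notes Stirling.simps [simp del] binomial_Suc_Suc [simp del]
  assumes "n \<ge> 1"
  shows "\<not> 3 dvd Stirling (n - 1) (n div 3) \<longleftrightarrow>
    n \<in> affine_image 3 1 T \<union> affine_image 3 2 T' \<union> affine_image 9 3 T \<and> n mod 9 \<noteq> 2"
    (is "?L \<longleftrightarrow> ?R")
proof -
  define a c r where "a = n div 9" and "c = n div 3 mod 3" and "r = n mod 3"
  have c: "c < 3" and r: "r < 3" by (simp_all add: c_def r_def)
  have "a = n div 3 div 3" by (simp add: a_def flip: div_mult2_eq)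
  then have n3: "n div 3 = 3 * a + c" by (simp add: c_def)
  have "n = 3 * (n div 3) + r" by (simp add: r_def)
  then have n: "n = 9 * a + 3 * c + r" by (simp add: n3)
  then have n9: "n mod 9 = 3 * c + r"
    using c r by (simp only: add.assoc mod_mult_self4) simp
  have im1: "n \<in> affine_image 3 1 T \<longleftrightarrow> r = 1 \<and> 3 * a + c \<in> T"
  proof -
    have "n \<in> affine_image 3 1 T \<longleftrightarrow> (\<exists>t \<in> T. n = 3 * t + 1)" by (auto simp: affine_image_def)
    moreover have "n = 3 * t + 1 \<longleftrightarrow> r = 1 \<and> t = 3 * a + c" for t
    proof -
      have "n = 3 * t + 1 \<longleftrightarrow> n mod 3 = 1 \<and> t = n div 3" by presburger
      then show ?thesis by (simp only: n3 r_def)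
    qed
    ultimately show ?thesis by auto
  qed
  have im2: "n \<in> affine_image 3 2 T' \<longleftrightarrow> r = 2 \<and> c \<noteq> 2 \<and> 3 * a + c \<in> T"
  proof -
    have "n \<in> affine_image 3 2 T' \<longleftrightarrow> (\<exists>t. t \<in> T \<and> t mod 3 \<noteq> 2 \<and> n = 3 * t + 2)"
      by (auto simp: affine_image_def T'_def)
    moreover have "n = 3 * t + 2 \<longleftrightarrow> r = 2 \<and> t = 3 * a + c" for t
    proof -
      have "n = 3 * t + 2 \<longleftrightarrow> n mod 3 = 2 \<and> t = n div 3" by presburger
      then show ?thesis by (simp only: n3 r_def)
    qed
    moreover have "(3 * a + c) mod 3 = c" using c by simp
    ultimately show ?thesis by auto
  qed
  have im3: "n \<in> affine_image 9 3 T \<longleftrightarrow> r = 0 \<and> c = 1 \<and> a \<in> T"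
  proof -
    have "n \<in> affine_image 9 3 T \<longleftrightarrow> (\<exists>t \<in> T. n = 9 * t + 3)" by (auto simp: affine_image_def)
    moreover have "n = 9 * t + 3 \<longleftrightarrow> r = 0 \<and> c = 1 \<and> t = a" for t
    proof -
      have "n = 9 * t + 3 \<longleftrightarrow> n mod 9 = 3 \<and> t = n div 9"
        using mult_div_mod_eq[of 9 n] by (intro iffI; (elim conjE, linarith)?) simp
      moreover have "3 * c + r = 3 \<longleftrightarrow> r = 0 \<and> c = 1" using r by presburger
      ultimately show ?thesis by (simp add: n9 a_def)
    qed
    ultimately show ?thesis by auto
  qed
  \<comment> \<open>For r = 2, \<open>T'\<close> excludes c = 2 and the condition modulo 9 excludes
    c = 0.\<close>
  have R: "?R \<longleftrightarrow> (r = 1 \<and> 3 * a + c \<in> T) \<or> (r = 2 \<and> c = 1 \<and> 3 * a + c \<in> T) \<or> (r = 0 \<and> c = 1 \<and> a \<in> T)"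
    unfolding Un_iff im1 im2 im3 n9 using c r by auto
  have L: "?L \<longleftrightarrow> \<not> 3 dvd Stirling (9 * a + 3 * c + r - 1) (3 * a + c)"
    unfolding n3 by (simp only: n[symmetric])
  have T0: "\<not> 3 dvd (4 * a) choose a \<longleftrightarrow> a \<in> T"
    using choose_not_dvd_3_iff_T[of 0 a] T_mult_3_iff[of a] by simp
  have "c = 0 \<or> c = 1 \<or> c = 2" "r = 0 \<or> r = 1 \<or> r = 2" using c r by auto
  then consider "c = 0" "r = 0" | "c = 0" "r = 1" | "c = 0" "r = 2" | "c = 1" "r = 0" | "c = 1" "r = 1"
    | "c = 1" "r = 2" | "c = 2" "r = 0" | "c = 2" "r = 1" | "c = 2" "r = 2" by blast
  then show ?thesis
  proof cases
    case 1
    then obtain b where b: "a = Suc b" using assms n by (cases a) auto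
    then have eq: "9 * a + 3 * c + r - 1 = 3 * a + (2 * (3 * b + 2) + 1)" using 1 by simp
    show ?thesis unfolding R L eq
      using Stirling_cong_3(1)[of a "3 * b + 2"] 1 by (simp add: cong_0_iff)
  next
    case 2
    \<comment> \<open>The two binomials differ by the factor 4, a unit modulo 3.\<close>
    have choose: "\<not> 3 dvd ((3 * a + a - 1) choose (3 * a)) \<longleftrightarrow> \<not> 3 dvd ((4 * a) choose a)"
    proof (cases "a = 0")
      case False
      then have "(4 * a) choose a = 4 * ((3 * a + a - 1) choose (3 * a))"
        using choose_pred_eq[of a 3] by simp
      moreover have "3 dvd 4 * x \<longleftrightarrow> 3 dvd x" for x :: nat by presburger
      ultimately show ?thesis by simp
    qed simp
    have eq: "9 * a + 3 * c + r - 1 = 3 * a + 2 * (3 * a)" using 2 by simp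
    show ?thesis unfolding R L eq
      using conjunct1[OF Stirling_cong_3(1)[of a "3 * a"]] choose 2 T0 by (simp add: cong_dvd_iff T_mult_3_iff)
  next
    case 3
    then have eq: "9 * a + 3 * c + r - 1 = 3 * a + (2 * (3 * a) + 1)" by simp
    show ?thesis unfolding R L eq
      using conjunct2[OF Stirling_cong_3(1)[of a "3 * a"]] 3 by (simp add: cong_0_iff)
  next
    case 4
    then have eq: "9 * a + 3 * c + r - 1 = 3 * a + 1 + (2 * (3 * a) + 1)" by simp
    show ?thesis unfolding R L eq
      using conjunct2[OF Stirling_cong_3(2)[of a "3 * a"]] T0 4 by (simp add: cong_dvd_iff)
  next
    case 5
    then have eq: "9 * a + 3 * c + r - 1 = 3 * a + 1 + 2 * (3 * a + 1)" by simp
    show ?thesis unfolding R L eq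
      using conjunct1[OF Stirling_cong_3(2)[of a "3 * a + 1"]] choose_not_dvd_3_iff_T[of 1 a] 5 by (simp add: cong_dvd_iff)
  next
    case 6
    then have eq: "9 * a + 3 * c + r - 1 = 3 * a + 1 + (2 * (3 * a + 1) + 1)" by simp
    show ?thesis unfolding R L eq
      using conjunct2[OF Stirling_cong_3(2)[of a "3 * a + 1"]] choose_not_dvd_3_iff_T[of 1 a] 6 by (simp add: cong_dvd_iff)
  next
    case 7
    then have eq: "9 * a + 3 * c + r - 1 = 3 * a + 2 + (2 * (3 * a + 1) + 1)" by simp
    show ?thesis unfolding R L eq
      using conjunct2[OF Stirling_cong_3(3)[of a "3 * a + 1"]] 7 by (simp add: cong_0_iff)
  next
    case 8
    then have eq: "9 * a + 3 * c + r - 1 = 3 * a + 2 + 2 * (3 * a + 2)" by simp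
    show ?thesis unfolding R L eq
      using conjunct1[OF Stirling_cong_3(3)[of a "3 * a + 2"]] choose_not_dvd_3_iff_T[of 2 a] 8 by (simp add: cong_dvd_iff)
  next
    case 9
    then have eq: "9 * a + 3 * c + r - 1 = 3 * a + 2 + (2 * (3 * a + 2) + 1)" by simp
    show ?thesis unfolding R L eq
      using conjunct2[OF Stirling_cong_3(3)[of a "3 * a + 2"]] 9 by (simp add: cong_0_iff)
  qed
qed

section \<open>The three claims on valuations\<close>

theorem mainTheorem3:
  fixes n :: nat
  assumes "n \<ge> 1"
  shows "\<exists>L0 :: nat. \<forall>L \<ge> L0.
    (multiplicity 2 (Stirling (2 ^ L + n - 1) n) = n div 2 + n mod 2 - 1 \<longleftrightarrow>
       (\<exists>(\<epsilon> :: nat) (s :: nat). \<epsilon> \<le> 2 \<and> n = 2 ^ \<epsilon> * (2 * s + 1) \<and> odd ((3 * s) choose s))) \<and>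
    (multiplicity 3 (Stirling (2 * 3 ^ L + n - 1) n) = 2 * (n div 3) + n mod 3 - 1 \<longleftrightarrow>
       n \<in> affine_image 3 1 T \<union> affine_image 3 2 T' \<union> affine_image 9 3 T \<and> n mod 9 \<noteq> 2) \<and>
    (\<forall>x :: nat. n = 9 * x + 2 \<longrightarrow>
       multiplicity 3 (Stirling (2 * 3 ^ L + n - 1) (n + 1)) \<ge> 6 * x \<and>
       (multiplicity 3 (Stirling (2 * 3 ^ L + n - 1) (n + 1)) = 6 * x \<longleftrightarrow> x \<in> T))"
proof (intro exI allI impI)
  \<comment> \<open>The threshold 2n is the sum of k = n - 1 and N = n + 1 required for the third
    claim; the first two, with N = n, need one less.\<close>
  fix L assume L: "L \<ge> 2 * n"
  let ?k = "n - 1"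
  have k: "?k < n" "?k < n + 1" "?k + n \<le> L" "?k + (n + 1) \<le> L" using assms L by auto
  have exp: "2 ^ L + n - 1 = (2 - 1) * 2 ^ L + ?k" "2 * 3 ^ L + n - 1 = (3 - 1) * 3 ^ L + ?k"
    using assms by auto
  have p: "prime (2 :: nat)" "prime (3 :: nat)" by simp_all
  \<comment> \<open>Since n \<ge> 1, the claimed value is k - [n/2]. Moving [n/2] to the left avoids
    truncated subtraction.\<close>
  have "multiplicity 2 (Stirling (2 ^ L + n - 1) n) = n div 2 + n mod 2 - 1 \<longleftrightarrow>
      multiplicity 2 (Stirling (2 ^ L + n - 1) n) + n div 2 = ?k"
    using assms div_mult_mod_eq[of n 2] by (intro iffI; linarith)
  also have "\<dots> \<longleftrightarrow> odd (Stirling ?k (n div 2))"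
    unfolding exp by (rule multiplicity_Stirling(2)[OF p(1) k(1) refl k(3)])
  also note odd_Stirling_half_iff[OF assms]
  finally have i: "multiplicity 2 (Stirling (2 ^ L + n - 1) n) = n div 2 + n mod 2 - 1 \<longleftrightarrow>
       (\<exists>(\<epsilon> :: nat) (s :: nat). \<epsilon> \<le> 2 \<and> n = 2 ^ \<epsilon> * (2 * s + 1) \<and> odd ((3 * s) choose s))" .
  have "multiplicity 3 (Stirling (2 * 3 ^ L + n - 1) n) = 2 * (n div 3) + n mod 3 - 1 \<longleftrightarrow>
      multiplicity 3 (Stirling (2 * 3 ^ L + n - 1) n) + n div 3 = ?k"
    using assms div_mult_mod_eq[of n 3] by (intro iffI; linarith)
  also have "\<dots> \<longleftrightarrow> \<not> 3 dvd Stirling ?k (n div 3)"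
    unfolding exp by (rule multiplicity_Stirling(2)[OF p(2) k(1) refl k(3)])
  also note Stirling_third_not_dvd_3_iff[OF assms]
  finally have ii: "multiplicity 3 (Stirling (2 * 3 ^ L + n - 1) n) = 2 * (n div 3) + n mod 3 - 1 \<longleftrightarrow>
       n \<in> affine_image 3 1 T \<union> affine_image 3 2 T' \<union> affine_image 9 3 T \<and> n mod 9 \<noteq> 2" .
  have iii: "multiplicity 3 (Stirling (2 * 3 ^ L + n - 1) (n + 1)) \<ge> 6 * x \<and>
       (multiplicity 3 (Stirling (2 * 3 ^ L + n - 1) (n + 1)) = 6 * x \<longleftrightarrow> x \<in> T)" if x: "n = 9 * x + 2" for x
  proof -
    let ?\<mu> = "multiplicity 3 (Stirling (2 * 3 ^ L + n - 1) (n + 1))"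
    \<comment> \<open>Now N = 9x + 3 and k = 9x + 1, so k - m = 6x, and S(9x + 1, 3x + 1) is C(4x,x)
      modulo 3.\<close>
    have m: "3 * x + 1 = (n + 1) div 3" using x by simp
    have "?\<mu> + (3 * x + 1) \<ge> ?k" "?\<mu> + (3 * x + 1) = ?k \<longleftrightarrow> \<not> 3 dvd Stirling ?k (3 * x + 1)"
      unfolding exp by (rule multiplicity_Stirling[OF p(2) k(2) m k(4)])+
    moreover have "?k = 3 * x + 1 + 2 * (3 * x)" using x by simp
    moreover have "\<not> 3 dvd Stirling (3 * x + 1 + 2 * (3 * x)) (3 * x + 1) \<longleftrightarrow> x \<in> T"
      using conjunct1[OF Stirling_cong_3(2)[of x "3 * x"]] choose_not_dvd_3_iff_T[of 0 x] T_mult_3_iff[of x]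
      by (simp add: cong_dvd_iff del: Stirling.simps)
    ultimately show ?thesis by auto
  qed
  show "(multiplicity 2 (Stirling (2 ^ L + n - 1) n) = n div 2 + n mod 2 - 1 \<longleftrightarrow>
       (\<exists>(\<epsilon> :: nat) (s :: nat). \<epsilon> \<le> 2 \<and> n = 2 ^ \<epsilon> * (2 * s + 1) \<and> odd ((3 * s) choose s))) \<and>
    (multiplicity 3 (Stirling (2 * 3 ^ L + n - 1) n) = 2 * (n div 3) + n mod 3 - 1 \<longleftrightarrow>
       n \<in> affine_image 3 1 T \<union> affine_image 3 2 T' \<union> affine_image 9 3 T \<and> n mod 9 \<noteq> 2) \<and>
    (\<forall>x :: nat. n = 9 * x + 2 \<longrightarrow>
       multiplicity 3 (Stirling (2 * 3 ^ L + n - 1) (n + 1)) \<ge> 6 * x \<and>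
       (multiplicity 3 (Stirling (2 * 3 ^ L + n - 1) (n + 1)) = 6 * x \<longleftrightarrow> x \<in> T))"
    using i ii iii by blast
qed

end
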